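(* Let $\mathbb F_q$ be a finite field of characteristic $p$ and $\mathbf w=(w_0,\dots,w_n)$ a vector of positive integers. Let $Z_{\mathrm{tw}}(\mathcal P_{\mathbf w},t)$ be the twist zeta function over $\mathbb F_q$ and $(b_0,\dots,b_n)$ its multiplicity spectrum. The following are equivalent: (a) $Z_{\mathrm{tw}}(\mathcal P_{\mathbf w},t)$ satisfies a single functional equation under $t\mapsto 1/(q^nt)$; (b) the multiplicity spectrum is palindromic, i.e. $b_j=b_{n-j}$ for all $0\le j\le n$; (c) $b_0=b_n$; (d) the prime-to-$p$ parts $w_0^{(p')},\dots,w_n^{(p')}$ of the weights are all equal. When these hold, with common value $c=w_i^{(p')}$, the spectrum is $(c,\dots,c)$. If $\gcd(w_0,\dots,w_n)=1$, these conditions hold if and only if every $w_i$ is a power of $p$ (including $p^0=1$), in which case all twists are trivial (that is, $\gcd(k_S,q^r-1)=1$ for every nonempty $S\subseteq\{0,\dots,n\}$ and every $r\ge1$, where $k_S=\gcd\{w_i:i\in S\}$) and $Z_{\mathrm{tw}}(\mathcal P_{\mathbf w},t)=Z(\mathbb P^n,t)=\prod_{j=0}^n(1-q^jt)^{-1}$.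
   Context: For $r\ge1$, $A_{\mathbf w}(q^r)$ is the number of orbits of $\mathbb F_{q^r}^\times$ on $\mathbb F_{q^r}^{n+1}\setminus\{0\}$ under $\lambda\cdot(x_0,\dots,x_n)=(\lambda^{w_0}x_0,\dots,\lambda^{w_n}x_n)$, and $Z_{\mathrm{tw}}(\mathcal P_{\mathbf w},t)=\exp\bigl(\sum_{r\ge1}A_{\mathbf w}(q^r)\,t^r/r\bigr)$. This is a rational function which can be written uniquely as a finite product $\prod_\alpha(1-\alpha t)^{-b(\alpha)}$ over distinct complex numbers $\alpha$, each of the form $\zeta q^j$ with $\zeta$ a root of unity and $0\le j\le n$, with $b(\alpha)\in\mathbb Z$. The multiplicity spectrum is $(b_0,\dots,b_n)$ with $b_j=\sum_{|\alpha|=q^j}b(\alpha)$. "Satisfies a single functional equation under $t\mapsto1/(q^nt)$" means that $Z_{\mathrm{tw}}(\mathcal P_{\mathbf w},1/(q^nt))=C\,t^{s}\,Z_{\mathrm{tw}}(\mathcal P_{\mathbf w},t)^{\pm1}$ for some nonzero constant $C$, some integer $s$ and some choice of sign. The prime-to-$p$ part of a positive integer $w$ is $w^{(p')}=w/p^{v_p(w)}$. *)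

theory Defs
  imports
    Complex_Main
    "HOL-Library.Cardinality"
    "HOL-Computational_Algebra.Computational_Algebra"
    "HOL-Algebra.Group_Action"
    "HOL-Algebra.Algebraic_Closure_Type"
begin

text \<open>
  The base field \<open>\<bbbF>\<^sub>q\<close> is a type \<open>'a\<close> of class \<open>finite_field\<close>, so that \<open>q = CARD('a)\<close> and
  \<open>p = CHAR('a)\<close>. A weight vector \<open>(w\<^sub>0, \<dots>, w\<^sub>n)\<close> is a function \<open>w :: nat \<Rightarrow> nat\<close> of which only
  the values at \<open>0, \<dots>, n\<close> matter; likewise, vectors of length \<open>n + 1\<close> are extensional functions
  on \<open>{..n}\<close>.
\<close>

section \<open>Counting twists\<close>

text \<open>The roots of \<open>X\<^bsup>q^r\<^esup> - X\<close> form the unique subfield with \<open>q\<^sup>r\<close> elements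
  of an algebraic closure of \<open>\<bbbF>\<^sub>q\<close>.\<close>

definition ext_field :: "nat \<Rightarrow> 'a::finite_field alg_closure set" where
  "ext_field r = {x. x ^ (CARD('a) ^ r) = x}"

definition ext_units :: "nat \<Rightarrow> 'a::finite_field alg_closure monoid" where
  "ext_units r = \<lparr>carrier = ext_field r - {0}, monoid.mult = (*), one = 1\<rparr>"

definition nonzero_vectors :: "nat \<Rightarrow> nat \<Rightarrow> (nat \<Rightarrow> 'a::finite_field alg_closure) set" where
  "nonzero_vectors n r = {x \<in> {..n} \<rightarrow>\<^sub>E ext_field r. \<exists>i\<le>n. x i \<noteq> 0}"

definition weighted_action ::
    "nat \<Rightarrow> (nat \<Rightarrow> nat) \<Rightarrow> nat \<Rightarrow> 'a::finite_field alg_closure \<Rightarrow>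
      (nat \<Rightarrow> 'a alg_closure) \<Rightarrow> (nat \<Rightarrow> 'a alg_closure)" where
  "weighted_action n w r l = (\<lambda>x\<in>nonzero_vectors n r. \<lambda>i\<in>{..n}. l ^ w i * x i)"

definition twist_count :: "'a::finite_field itself \<Rightarrow> nat \<Rightarrow> (nat \<Rightarrow> nat) \<Rightarrow> nat \<Rightarrow> nat" where
  "twist_count _ n w r =
     card (orbits (ext_units r :: 'a alg_closure monoid) (nonzero_vectors n r) (weighted_action n w r))"

section \<open>Zeta functions\<close>

definition zeta_of_counts :: "(nat \<Rightarrow> nat) \<Rightarrow> complex fps" where
  "zeta_of_counts N =
     fps_exp 1 oo Abs_fps (\<lambda>r. if r = 0 then 0 else of_nat (N r) / of_nat r)"

definition twist_zeta :: "'a::finite_field itself \<Rightarrow> nat \<Rightarrow> (nat \<Rightarrow> nat) \<Rightarrow> complex fps" where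
  "twist_zeta T n w = zeta_of_counts (twist_count T n w)"

text \<open>Points of projective \<open>n\<close>-space over \<open>\<bbbF>\<^bsub>q^r\<^esub>\<close>: the lines through the origin in
  \<open>(n + 1)\<close>-space.\<close>

definition projective_points :: "nat \<Rightarrow> nat \<Rightarrow> (nat \<Rightarrow> 'a::finite_field alg_closure) set set" where
  "projective_points n r =
     (\<lambda>x. (\<lambda>l. \<lambda>i\<in>{..n}. l * x i) ` ext_field r) ` nonzero_vectors n r"

definition projective_zeta :: "'a::finite_field itself \<Rightarrow> nat \<Rightarrow> complex fps" where
  "projective_zeta _ n =
     zeta_of_counts (\<lambda>r. card (projective_points n r :: (nat \<Rightarrow> 'a alg_closure) set set))"

section \<open>Multiplicity spectrum\<close>

text \<open>\<open>zeta_factorization q n Z b\<close> says that \<open>Z = \<Prod>\<^sub>\<alpha> (1 - \<alpha> t)\<^bsup>-b(\<alpha>)\<^esup>\<close> is a finite product,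
  with every \<open>\<alpha>\<close> that occurs a root of unity times some \<open>q\<^sup>j\<close>, \<open>0 \<le> j \<le> n\<close>. The integer powers make
  sense because the power series \<open>1 - \<alpha> t\<close> is invertible.\<close>

definition zeta_factorization :: "nat \<Rightarrow> nat \<Rightarrow> complex fps \<Rightarrow> (complex \<Rightarrow> int) \<Rightarrow> bool" where
  "zeta_factorization q n Z b \<longleftrightarrow>
     finite {\<alpha>. b \<alpha> \<noteq> 0} \<and>
     (\<forall>\<alpha>. b \<alpha> \<noteq> 0 \<longrightarrow> (\<exists>\<zeta> m j. m > 0 \<and> \<zeta> ^ m = 1 \<and> j \<le> n \<and> \<alpha> = \<zeta> * of_nat q ^ j)) \<and>
     Z = (\<Prod>\<alpha> | b \<alpha> \<noteq> 0. (1 - fps_const \<alpha> * fps_X) powi (- b \<alpha>))"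

definition twist_exponent :: "'a::finite_field itself \<Rightarrow> nat \<Rightarrow> (nat \<Rightarrow> nat) \<Rightarrow> complex \<Rightarrow> int" where
  "twist_exponent T n w = (THE b. zeta_factorization CARD('a) n (twist_zeta T n w) b)"

definition multiplicity_spectrum :: "'a::finite_field itself \<Rightarrow> nat \<Rightarrow> (nat \<Rightarrow> nat) \<Rightarrow> nat \<Rightarrow> int" where
  "multiplicity_spectrum T n w j =
     (\<Sum>\<alpha> | twist_exponent T n w \<alpha> \<noteq> 0 \<and> norm \<alpha> = of_nat CARD('a) ^ j. twist_exponent T n w \<alpha>)"

section \<open>Functional equation\<close>

text \<open>The series \<open>Z\<close> is the expansion at \<open>0\<close> of a rational function \<open>P / Q\<close>, and
  \<open>Z(1/(Nt)) = C t\<^sup>s Z(t)\<^bsup>\<plusminus>1\<^esup>\<close> as rational functions. Two rational functions are equal iff their values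
  agree for all but finitely many arguments, which also disposes of poles, zeros and \<open>t = 0\<close>; so
  the choice of \<open>P\<close> and \<open>Q\<close> is immaterial.\<close>

definition single_functional_equation :: "nat \<Rightarrow> complex fps \<Rightarrow> bool" where
  "single_functional_equation N Z \<longleftrightarrow>
     (\<exists>P Q. Q \<noteq> 0 \<and> Z * fps_of_poly Q = fps_of_poly P \<and>
        (\<exists>C s e. C \<noteq> 0 \<and> e \<in> {1, -1 :: int} \<and>
           (\<forall>\<^sub>F t in cofinite.
              poly P (1 / (of_nat N * t)) / poly Q (1 / (of_nat N * t)) =
              C * t powi s * (poly P t / poly Q t) powi e)))"

definition prime_to_part :: "nat \<Rightarrow> nat \<Rightarrow> nat" where
  "prime_to_part p w = w div p ^ multiplicity p w"

end

theory Submission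
  imports Defs "HOL-Number_Theory.Number_Theory" "HOL-Algebra.Sylow"
begin

text \<open>
  A unit of order \<open>d\<close> fixes exactly the vectors supported on \<open>{i. d dvd w i}\<close>. The unit group is
  cyclic, so Burnside's lemma gives, with \<open>Q = q\<^sup>r\<close> and \<open>m(d)\<close> the number of weights divisible by \<open>d\<close>,
  \<open>A(Q) = \<Sum> \<phi>(d) (1 + Q + \<dots> + Q\<^bsup>m(d) - 1\<^esup>)\<close>, the sum being over the divisors \<open>d\<close> of \<open>Q - 1\<close>.
  The condition \<open>d dvd q\<^sup>r - 1\<close> says that the order of \<open>q\<close> modulo \<open>d\<close> divides \<open>r\<close>; detecting it with roots
  of unity turns \<open>A(q\<^sup>r)\<close> into a power sum \<open>\<Sum>\<alpha>\<^sup>r\<close> over a finite multiset \<open>M\<close>, whence the zeta function is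
  \<open>1 / \<Prod>(1 - \<alpha> t)\<close> and \<open>b\<^sub>j\<close> is the sum of \<open>\<phi>(d)\<close> over the \<open>d\<close> prime to \<open>p\<close> with \<open>m(d) > j\<close>. The spectrum
  is therefore decreasing, and \<open>b\<^sub>0 = b\<^sub>n\<close> iff each \<open>d\<close> prime to \<open>p\<close> that divides one weight divides
  all of them. Comparing the zeros of both sides, a functional equation is the invariance of \<open>M\<close>
  under \<open>\<alpha> \<mapsto> q\<^sup>n / \<alpha>\<close>.
\<close>

section \<open>Zeta functions of power sums\<close>

text \<open>Constant term 1 instead of leading coefficient 1: this is the shape of the denominator
  of a zeta function, and it is invertible as a power series. An element 0 contributes the factor 1
  and leaves no trace, hence the recurring condition \<open>0 \<notin># M\<close>.\<close>

definition reciprocal_poly :: "complex multiset \<Rightarrow> complex poly" where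
  "reciprocal_poly M = (\<Prod>a\<in>#M. [:1, -a:])"

lemma reciprocal_poly_empty [simp]: "reciprocal_poly {#} = 1"
  and reciprocal_poly_add_mset [simp]:
    "reciprocal_poly (add_mset a M) = [:1, -a:] * reciprocal_poly M"
  by (simp_all add: reciprocal_poly_def)

lemma reciprocal_poly_nonzero [simp]: "reciprocal_poly M \<noteq> 0"
  by (induction M) (auto simp del: mult_pCons_left)

lemma poly_reciprocal_poly_0 [simp]: "poly (reciprocal_poly M) 0 = 1"
  by (induction M) auto

lemma proots_reciprocal_poly:
  assumes "0 \<notin># M"
  shows "proots (reciprocal_poly M) = image_mset inverse M"
  using assms
proof (induction M)
  case (add a M)
  have "[:1, -a:] = smult (-a) [:- inverse a, 1:]"
    using add.prems by simp
  then have "proots [:1, -a:] = {#inverse a#}"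
    using add.prems by (subst \<open>[:1, -a:] = _\<close>, subst proots_smult) simp_all
  with add show ?case
    by (simp add: proots_mult del: mult_pCons_left)
qed simp

text \<open>The roots with multiplicity are the inverses of the elements, and inverting them once
  more recovers the multiset.\<close>

lemma reciprocal_poly_inject:
  assumes "0 \<notin># M" "0 \<notin># M'"
  shows "reciprocal_poly M = reciprocal_poly M' \<longleftrightarrow> M = M'"
proof
  assume "reciprocal_poly M = reciprocal_poly M'"
  then have "image_mset inverse (image_mset inverse M) = image_mset inverse (image_mset inverse M')"
    using assms by (metis proots_reciprocal_poly)
  then show "M = M'"
    by (simp add: multiset.map_comp comp_def)
qed simp

lemma reciprocal_poly_add: "reciprocal_poly (M + M') = reciprocal_poly M * reciprocal_poly M'"
  by (simp add: reciprocal_poly_def)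

lemma reciprocal_poly_sum:
  "finite A \<Longrightarrow> reciprocal_poly (\<Sum>a\<in>A. f a) = (\<Prod>a\<in>A. reciprocal_poly (f a))"
  by (induction A rule: finite_induct) (auto simp: reciprocal_poly_add)

lemma reciprocal_poly_replicate: "reciprocal_poly (replicate_mset k a) = [:1, -a:] ^ k"
  by (simp add: reciprocal_poly_def)

text \<open>Logarithmic differentiation. With \<open>F\<close> the exponent of the zeta function,
  \<open>Z' = Z * F'\<close>, where \<open>F'\<close> is the generating series of the power sums.
  The reciprocal polynomial has the opposite logarithmic derivative, so the product has derivative 0
  and equals its constant term 1.\<close>

lemma zeta_of_counts_mult_reciprocal_poly:
  assumes N: "\<And>r. r > 0 \<Longrightarrow> of_nat (N r) = (\<Sum>a\<in>#M. a ^ r)"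
  shows "zeta_of_counts N * fps_of_poly (reciprocal_poly M) = 1"
proof -
  define F :: "complex fps" where
    "F = Abs_fps (\<lambda>r. if r = 0 then 0 else of_nat (N r) / of_nat r)"
  let ?D = "\<lambda>M. fps_of_poly (reciprocal_poly M)"
  let ?G = "\<lambda>M. Abs_fps (\<lambda>r. \<Sum>a\<in>#M. a ^ Suc r)"
  have "F $ 0 = 0"
    by (simp add: F_def)
  then have Z': "fps_deriv (zeta_of_counts N) = zeta_of_counts N * fps_deriv F"
    unfolding zeta_of_counts_def F_def[symmetric] by (simp add: fps_compose_deriv)
  have F': "fps_deriv F = ?G M"
    by (rule fps_ext) (simp add: F_def N del: of_nat_Suc)
  have D': "fps_deriv (?D M) = - ?D M * ?G M" for M
  proof (induction M)
    case (add a M)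
    let ?L = "1 - fps_const a * fps_X"
    let ?g = "Abs_fps (\<lambda>r. a ^ Suc r)"
    have G: "?G (add_mset a M) = ?g + ?G M"
      by (rule fps_ext) simp
    \<comment> \<open>\<open>?g\<close> is the geometric series of a / (1 - a t), which is minus the
      logarithmic derivative of the new factor \<open>?L\<close>.\<close>
    have g: "?L * ?g = fps_const a"
    proof (rule fps_ext)
      fix r show "(?L * ?g) $ r = fps_const a $ r"
        by (cases r) (simp_all add: left_diff_distrib mult.assoc)
    qed
    have D: "?D (add_mset a M) = ?L * ?D M"
      by (simp add: fps_of_poly_mult fps_of_poly_pCons algebra_simps del: mult_pCons_left)
    have "fps_deriv (?D (add_mset a M)) = - fps_const a * ?D M + ?L * fps_deriv (?D M)"
      by (simp only: D fps_deriv_mult) simp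
    also have "\<dots> = - (?L * ?g) * ?D M + ?L * (- ?D M * ?G M)"
      by (simp only: add.IH g)
    also have "\<dots> = - ?D (add_mset a M) * ?G (add_mset a M)"
      by (simp only: D G) (simp add: algebra_simps)
    finally show ?case .
  qed (simp add: fps_zero_def[symmetric])
  have "fps_deriv (zeta_of_counts N * ?D M) = 0"
    by (simp add: Z' F' D' algebra_simps)
  then have "zeta_of_counts N * ?D M = fps_const ((zeta_of_counts N * ?D M) $ 0)"
    by (simp only: fps_deriv_eq_0_iff)
  also have "(zeta_of_counts N * ?D M) $ 0 = 1"
    by (simp add: zeta_of_counts_def fps_compose_nth_0 flip: poly_0_coeff_0)
  finally show ?thesis
    by simp
qed

section \<open>Uniqueness of the exponents in a factorization\<close>

lemma powi_uminus_mult: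
  fixes L :: "'a::field fps"
  assumes "L $ 0 \<noteq> 0"
  shows "L powi (- k) * L ^ nat k = L ^ nat (- k)"
proof (cases "k \<le> 0")
  case False
  then have "L powi (- k) * L ^ nat k = (inverse L * L) ^ nat k"
    by (simp add: power_int_def power_mult_distrib)
  also have "inverse L * L = 1"
    using assms by (rule inverse_mult_eq_1)
  finally show ?thesis
    using False by simp
qed (simp add: power_int_def)

text \<open>Multiplying by the factors with positive exponent clears all denominators and turns a
  factorization into an equality of reciprocal polynomials, hence of multisets. This determines the
  exponents as the multiplicities in \<open>M\<close>.\<close>

lemma zeta_factorization_iff:
  assumes M: "\<And>a. a \<in># M \<Longrightarrow> \<exists>\<zeta> m j. m > 0 \<and> \<zeta> ^ m = 1 \<and> j \<le> n \<and> a = \<zeta> * of_nat q ^ j"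
    and Z: "Z * fps_of_poly (reciprocal_poly M) = 1" and q: "q > 0"
  shows "zeta_factorization q n Z b \<longleftrightarrow> b = (\<lambda>a. int (count M a))"
proof -
  \<comment> \<open>Zero is neither in \<open>M\<close> nor in the support of a factorization; this
    is what makes the passage from polynomials back to multisets injective.\<close>
  have nz: "a \<noteq> 0" if "\<exists>\<zeta> m j. m > 0 \<and> \<zeta> ^ m = 1 \<and> j \<le> n \<and> a = \<zeta> * of_nat q ^ j" for a :: complex
    using that q by (auto simp: power_0_left)
  have M0: "0 \<notin># M"
    using nz M by blast
  let ?L = "\<lambda>a. 1 - fps_const a * fps_X :: complex fps"
  let ?W = "\<lambda>b. \<Prod>a | b a \<noteq> 0. ?L a powi (- b a)"
  let ?P = "\<lambda>b. \<Sum>a | b a \<noteq> 0. replicate_mset (nat (b a)) a :: complex multiset"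
  let ?N = "\<lambda>b. \<Sum>a | b a \<noteq> 0. replicate_mset (nat (- b a)) a :: complex multiset"
  have L: "?L a = fps_of_poly [:1, -a:]" for a
    by (simp add: fps_of_poly_pCons algebra_simps)
  have prodL: "fps_of_poly (reciprocal_poly (\<Sum>a\<in>A. replicate_mset (k a) a)) = (\<Prod>a\<in>A. ?L a ^ k a)"
    if "finite A" for A k
    using that by (simp only: reciprocal_poly_sum reciprocal_poly_replicate fps_of_poly_prod
        fps_of_poly_power L)
  have W: "?W b * fps_of_poly (reciprocal_poly (?P b)) = fps_of_poly (reciprocal_poly (?N b))"
    if "finite {a. b a \<noteq> 0}" for b
    by (simp add: prodL that powi_uminus_mult flip: prod.distrib)
  have cnt: "count (\<Sum>a | b a \<noteq> 0. replicate_mset (nat (k a)) a) x = nat (k x)"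
    if "finite {a. b a \<noteq> 0}" "\<And>x. b x = 0 \<Longrightarrow> k x = 0" for b k :: "complex \<Rightarrow> int" and x
  proof -
    have "count (\<Sum>a | b a \<noteq> 0. replicate_mset (nat (k a)) a) x
      = (\<Sum>a | b a \<noteq> 0. if a = x then nat (k a) else 0)"
      by (simp add: count_sum eq_commute[of x])
    also have "\<dots> = nat (k x)"
      using that by (auto simp: sum.delta)
    finally show ?thesis .
  qed
  \<comment> \<open>\<open>?P b\<close> and \<open>?N b\<close> are the positive and negative parts
    of \<open>b\<close> as multisets. Cross-multiplying by nonzero series leaves only polynomials
    with constant term 1.\<close>
  have one: "?W b = Z \<longleftrightarrow> ?P b = M + ?N b"
    if fin: "finite {a. b a \<noteq> 0}" and b0: "b 0 = 0" for b
  proof -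
    have nz': "fps_of_poly (reciprocal_poly K) \<noteq> 0" for K
      by simp
    have "?W b = Z \<longleftrightarrow> ?W b * fps_of_poly (reciprocal_poly (?P b)) * fps_of_poly (reciprocal_poly M)
        = Z * fps_of_poly (reciprocal_poly (?P b)) * fps_of_poly (reciprocal_poly M)"
      by simp
    also have "\<dots> \<longleftrightarrow> fps_of_poly (reciprocal_poly (?N b)) * fps_of_poly (reciprocal_poly M)
        = (Z * fps_of_poly (reciprocal_poly M)) * fps_of_poly (reciprocal_poly (?P b))"
      by (subst W[OF fin]) (simp only: mult_ac)
    also have "\<dots> \<longleftrightarrow> reciprocal_poly (M + ?N b) = reciprocal_poly (?P b)"
      by (simp add: Z reciprocal_poly_add mult.commute flip: fps_of_poly_mult)
    also have "\<dots> \<longleftrightarrow> M + ?N b = ?P b"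
      using M0 b0 fin by (intro reciprocal_poly_inject) (auto simp: set_mset_sum)
    finally show ?thesis
      by auto
  qed
  show ?thesis
  proof
    assume zf: "zeta_factorization q n Z b"
    then have fin: "finite {a. b a \<noteq> 0}" and b0: "b 0 = 0" and W': "?W b = Z"
      using nz unfolding zeta_factorization_def by (blast, metis, metis)
    from one[OF fin b0] W' have "?P b = M + ?N b"
      by simp
    then have *: "nat (b x) = count M x + nat (- b x)" for x
      using cnt[OF fin, of b x] cnt[OF fin, of "\<lambda>a. - b a" x] by simp
    \<comment> \<open>Of \<open>nat (b x)\<close> and \<open>nat (- b x)\<close> at least one is 0,
      so adding a multiplicity to the second to get the first leaves no room for a negative
      exponent.\<close>
    have "b x = int (count M x)" for x
      using *[of x] by (cases "b x \<ge> 0") simp_all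
    then show "b = (\<lambda>a. int (count M a))"
      by auto
  next
    assume b: "b = (\<lambda>a. int (count M a))"
    have supp: "{a. b a \<noteq> 0} = set_mset M"
      by (auto simp: b)
    then have fin: "finite {a. b a \<noteq> 0}"
      by simp
    have b0: "b 0 = 0"
      using M0 by (simp add: b count_eq_zero_iff)
    have "?P b = M + ?N b"
      using cnt[OF fin, of b] cnt[OF fin, of "\<lambda>a. - b a"] by (intro multiset_eqI) (simp add: b)
    with one[OF fin b0] have "?W b = Z"
      by simp
    with fin show "zeta_factorization q n Z b"
      using M supp unfolding zeta_factorization_def by blast
  qed
qed

section \<open>Functional equations as a symmetry of the multiset\<close>

lemma poly_eq_if_monomial_multiple:
  fixes P R :: "complex poly"
  assumes "poly P 0 = 1" "poly R 0 = 1"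
    and ev: "\<forall>\<^sub>F t in cofinite. poly P t = c * t powi k * poly R t"
  shows "P = R"
proof -
  have eqI: "f = g" if "\<forall>\<^sub>F t in cofinite. poly f t = poly g t" for f g :: "complex poly"
  proof (rule ccontr)
    assume "f \<noteq> g"
    then have "finite {t. poly (f - g) t = 0}"
      by (intro poly_roots_finite) simp
    moreover have "{t. poly f t \<noteq> poly g t} = - {t. poly (f - g) t = 0}"
      by auto
    ultimately show False
      using that by (metis eventually_cofinite finite_compl infinite_UNIV_char_0)
  qed
  have ev0: "\<forall>\<^sub>F t in cofinite. t \<noteq> (0::complex)"
    by (simp add: eventually_cofinite)
  show ?thesis
  proof (cases "k \<ge> 0")
    case True
    \<comment> \<open>Now an identity of polynomials. At 0 it reads 1 = c * 0^k, which forces k = 0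
      and c = 1.\<close>
    have "P = smult c (monom 1 (nat k)) * R"
      using ev by (intro eqI, eventually_elim) (use True in \<open>simp add: poly_monom power_int_def\<close>)
    with assms(1,2) show ?thesis
      by (auto simp: poly_monom power_0_left monom_0 split: if_splits)
  next
    case False
    \<comment> \<open>The power of t moves to the left, where it vanishes at 0. So c = 0 and then P
      = 0, against the value 1 at 0.\<close>
    have "monom 1 (nat (- k)) * P = smult c R"
      using ev ev0
    proof (intro eqI, eventually_elim)
      case (elim t)
      have "t ^ nat (- k) * t powi k = 1"
        using False elim by (simp add: power_int_def field_simps)
      with elim show ?case
        by (simp add: poly_monom)
    qed
    then have "poly (monom 1 (nat (- k)) * P) 0 = poly (smult c R) 0"
      by simp
    with False assms(2) have "c = 0"
      by (simp add: poly_monom power_0_left)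
    with \<open>monom 1 (nat (- k)) * P = smult c R\<close> have "P = 0"
      by (simp add: monom_eq_0_iff)
    with assms(1) show ?thesis
      by simp
  qed
qed

text \<open>Factor by factor, 1 - a / (N t) = - (a / N) t^(-1) (1 - (N / a) t). The constant
  \<open>K\<close> is the product of the - a / N.\<close>

lemma poly_reciprocal_poly_reflect:
  fixes N :: complex
  assumes "0 \<notin># M" "N \<noteq> 0"
  obtains K where "K \<noteq> 0"
    "\<And>t. t \<noteq> 0 \<Longrightarrow> poly (reciprocal_poly M) (1 / (N * t)) =
       K * t powi (- int (size M)) * poly (reciprocal_poly (image_mset (\<lambda>a. N / a) M)) t"
proof -
  have "\<exists>K. K \<noteq> 0 \<and> (\<forall>t. t \<noteq> 0 \<longrightarrow> poly (reciprocal_poly M) (1 / (N * t)) =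
       K * t powi (- int (size M)) * poly (reciprocal_poly (image_mset (\<lambda>a. N / a) M)) t)"
    using assms(1)
  proof (induction M)
    case empty
    show ?case
      by (intro exI[of _ 1]) simp
  next
    case (add a M)
    then obtain K where K: "K \<noteq> 0" "\<And>t. t \<noteq> 0 \<Longrightarrow> poly (reciprocal_poly M) (1 / (N * t)) =
       K * t powi (- int (size M)) * poly (reciprocal_poly (image_mset (\<lambda>a. N / a) M)) t"
      by auto
    have "a \<noteq> 0"
      using add.prems by auto
    have pw: "t powi (- int (size (add_mset a M))) = t powi (- int (size M)) / t" if "t \<noteq> 0" for t :: complex
      using that by (simp add: power_int_diff power_int_minus field_simps)
    have "poly (reciprocal_poly (add_mset a M)) (1 / (N * t)) =
       (- a / N * K) * t powi (- int (size (add_mset a M)))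
         * poly (reciprocal_poly (image_mset (\<lambda>a. N / a) (add_mset a M))) t" if "t \<noteq> 0" for t
    proof -
      have "poly [:1, -a:] (1 / (N * t)) = - a / N / t * poly [:1, - (N / a):] t"
        using that \<open>a \<noteq> 0\<close> assms(2) by (simp add: field_simps)
      then show ?thesis
        by (simp add: K(2) that pw del: mult_pCons_left size_add_mset)
    qed
    then show ?case
      using \<open>a \<noteq> 0\<close> assms(2) K(1) by (intro exI[of _ "- a / N * K"]) simp
  qed
  with that show ?thesis
    by blast
qed

text \<open>Here \<open>Z\<close> is the inverse of \<open>?D\<close>, and the reflection replaces
  \<open>?D\<close> by the polynomial of \<open>?M'\<close> up to a monomial. The sign 1 identifies
  the two polynomials. The sign -1 would make their product 1, so that \<open>M\<close> would be
  empty.\<close>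

lemma single_functional_equation_iff:
  assumes M: "0 \<notin># M" "M \<noteq> {#}" and N: "N > 0"
    and Z: "Z * fps_of_poly (reciprocal_poly M) = 1"
  shows "single_functional_equation N Z \<longleftrightarrow> image_mset (\<lambda>a. of_nat N / a) M = M"
proof -
  let ?D = "reciprocal_poly M"
  let ?N = "of_nat N :: complex"
  let ?M' = "image_mset (\<lambda>a. ?N / a) M"
  have N0: "?N \<noteq> 0"
    using N by simp
  obtain K where K: "K \<noteq> 0"
    "\<And>t. t \<noteq> 0 \<Longrightarrow> poly ?D (1 / (?N * t)) = K * t powi (- int (size M)) * poly (reciprocal_poly ?M') t"
    using poly_reciprocal_poly_reflect[OF M(1) N0] by blast
  have M'0: "0 \<notin># ?M'"
    using M(1) N0 by auto
  have ev0: "\<forall>\<^sub>F t in cofinite. t \<noteq> (0::complex)"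
    by (simp add: eventually_cofinite)
  show ?thesis
  proof
    assume "single_functional_equation N Z"
    then obtain P Q C s e where Q: "Q \<noteq> 0" "Z * fps_of_poly Q = fps_of_poly P" "C \<noteq> 0"
      "e \<in> {1, -1 :: int}" and ev: "\<forall>\<^sub>F t in cofinite. poly P (1 / (?N * t)) / poly Q (1 / (?N * t)) =
              C * t powi s * (poly P t / poly Q t) powi e"
      unfolding single_functional_equation_def by blast
    \<comment> \<open>Every fraction representing \<open>Z\<close> is an expansion of 1 /
      \<open>?D\<close> by its numerator, so the equation can be rewritten in terms of
      \<open>?D\<close> alone.\<close>
    have "fps_of_poly Q = (Z * fps_of_poly ?D) * fps_of_poly Q"
      by (simp add: Z)
    also have "\<dots> = fps_of_poly (P * ?D)"
      using Q(2) by (simp add: fps_of_poly_mult mult_ac)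
    finally have QPD: "Q = P * ?D"
      by simp
    then have "P \<noteq> 0"
      using Q(1) by auto
    have evP: "\<forall>\<^sub>F t in cofinite. poly P t \<noteq> 0"
      using poly_roots_finite[OF \<open>P \<noteq> 0\<close>] by (simp add: eventually_cofinite)
    have evD: "\<forall>\<^sub>F t in cofinite. poly ?D t \<noteq> 0"
      using poly_roots_finite[of ?D] by (simp add: eventually_cofinite)
    \<comment> \<open>With the convention 1 / 0 = 0 the substitution is injective on all complex
      numbers, so finite exceptional sets have finite preimages.\<close>
    have lim: "filterlim (\<lambda>t. 1 / (?N * t)) cofinite cofinite"
    proof -
      have "inj (\<lambda>t. 1 / (?N * t))"
        using N0 by (auto simp: inj_def field_simps)
      then show ?thesis
        using finite_vimageI[of _ "\<lambda>t. 1 / (?N * t)"]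
        by (fastforce simp: filterlim_iff eventually_cofinite vimage_def)
    qed
    have evP': "\<forall>\<^sub>F t in cofinite. poly P (1 / (?N * t)) \<noteq> 0"
      using evP lim by (auto simp: filterlim_iff)
    have evD': "\<forall>\<^sub>F t in cofinite. poly ?D (1 / (?N * t)) \<noteq> 0"
      using evD lim by (auto simp: filterlim_iff)
    have FE: "\<forall>\<^sub>F t in cofinite. inverse (poly ?D (1 / (?N * t))) = C * t powi s * inverse (poly ?D t) powi e"
      using ev evP evP' by eventually_elim (simp add: QPD field_simps)
    consider "e = 1" | "e = -1"
      using Q(4) by auto
    then show "?M' = M"
    proof cases
      case 1
      have "\<forall>\<^sub>F t in cofinite. poly ?D t =
          C * K * t powi (s - int (size M)) * poly (reciprocal_poly ?M') t"
        using FE evD evD' ev0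
      proof eventually_elim
        case (elim t)
        then have "poly ?D t = C * t powi s * poly ?D (1 / (?N * t))"
          by (simp add: 1 field_simps)
        also have "\<dots> = C * K * (t powi s * t powi (- int (size M))) * poly (reciprocal_poly ?M') t"
          using elim by (simp add: K(2))
        also have "t powi s * t powi (- int (size M)) = t powi (s - int (size M))"
          using elim by (simp add: power_int_diff power_int_minus field_simps)
        finally show ?case .
      qed
      then have "?D = reciprocal_poly ?M'"
        by (rule poly_eq_if_monomial_multiple[rotated 2]) simp_all
      then show ?thesis
        using reciprocal_poly_inject[OF M(1) M'0] by simp
    next
      case 2
      have "\<forall>\<^sub>F t in cofinite. poly 1 t =
          C * K * t powi (s - int (size M)) * poly (reciprocal_poly ?M' * ?D) t"
        using FE evD evD' ev0
      proof eventually_elim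
        case (elim t)
        then have "1 = C * t powi s * poly ?D (1 / (?N * t)) * poly ?D t"
          by (simp add: 2 power_int_minus field_simps)
        also have "\<dots> = C * K * (t powi s * t powi (- int (size M))) * poly (reciprocal_poly ?M' * ?D) t"
          using elim by (simp add: K(2))
        also have "t powi s * t powi (- int (size M)) = t powi (s - int (size M))"
          using elim by (simp add: power_int_diff power_int_minus field_simps)
        finally show ?case
          by simp
      qed
      then have "1 = reciprocal_poly ?M' * ?D"
        by (rule poly_eq_if_monomial_multiple[rotated 2]) simp_all
      then have "reciprocal_poly (?M' + M) = reciprocal_poly {#}"
        by (simp add: reciprocal_poly_add)
      moreover have "0 \<notin># ?M' + M"
        using M(1) M'0 by simp
      ultimately have "?M' + M = {#}"
        by (subst (asm) reciprocal_poly_inject) auto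
      with M(2) show ?thesis
        by simp
    qed
  next
    assume eq: "?M' = M"
    \<comment> \<open>The fraction 1 / \<open>?D\<close> serves as witness. The reflection formula
      with \<open>?M' = M\<close> supplies the constant 1 / K and the exponent
      \<open>size M\<close>, with sign 1.\<close>
    have "\<forall>\<^sub>F t in cofinite. poly 1 (1 / (?N * t)) / poly ?D (1 / (?N * t)) =
              inverse K * t powi int (size M) * (poly 1 t / poly ?D t) powi 1"
      using ev0
    proof eventually_elim
      case (elim t)
      show ?case
        by (subst K(2)[unfolded eq, OF elim]) (simp add: power_int_minus divide_inverse mult_ac)
    qed
    with K(1) Z show "single_functional_equation N Z"
      unfolding single_functional_equation_def
      by (intro exI[of _ 1] exI[of _ ?D] exI[of _ "inverse K"] exI[of _ "int (size M)"] exI[of _ 1] conjI)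
        auto
  qed
qed

section \<open>The finite subfields of the algebraic closure\<close>

text \<open>Cauchy's theorem for the additive group: Sylow's theorem with exponent 1 gives a
  subgroup of order exactly \<open>l\<close>. A nonzero x in it satisfies l x = 0, so the
  characteristic divides \<open>l\<close>, and both are prime.\<close>

lemma prime_dvd_CARD_finite_field:
  assumes "prime l" "l dvd CARD('a::finite_field)"
  shows "l = CHAR('a)"
proof -
  define G :: "'a monoid" where "G = \<lparr>carrier = UNIV, monoid.mult = (+), one = 0\<rparr>"
  interpret G: group G
  proof (rule groupI)
    fix x assume "x \<in> carrier G"
    show "\<exists>y\<in>carrier G. y \<otimes>\<^bsub>G\<^esub> x = \<one>\<^bsub>G\<^esub>"
      by (rule bexI[of _ "- x"]) (simp_all add: G_def)
  qed (simp_all add: G_def add.assoc)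
  have pow: "x [^]\<^bsub>G\<^esub> (k :: nat) = of_nat k * x" for x k
    by (induction k) (simp_all add: G_def algebra_simps nat_pow_def)
  have "Coset.order G = l ^ 1 * (CARD('a) div l)"
    using assms(2) by (simp add: Coset.order_def G_def)
  then obtain H where H: "subgroup H G" "card H = l"
    using sylow_thm[OF assms(1) G.is_group, of 1 "CARD('a) div l"] by (auto simp: G_def)
  interpret H: group "G\<lparr>carrier := H\<rparr>"
    using H(1) by (rule G.subgroup_imp_group)
  have "1 < card H"
    unfolding H(2) using assms(1) by (rule prime_gt_1_nat)
  then have "\<not> H \<subseteq> {0}"
    using card_mono[of "{0}" H] by auto
  then obtain x where x: "x \<in> H" "x \<noteq> 0"
    by auto
  have "x [^]\<^bsub>G\<^esub> l = x [^]\<^bsub>G\<lparr>carrier := H\<rparr>\<^esub> Coset.order (G\<lparr>carrier := H\<rparr>)"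
    using H(2) by (simp add: Coset.order_def G.nat_pow_consistent[of x l H])
  also have "\<dots> = \<one>\<^bsub>G\<^esub>"
    using x(1) H.pow_order_eq_1[of x] by simp
  finally have "of_nat l * x = 0"
    unfolding pow by (simp add: G_def)
  then have "CHAR('a) dvd l"
    using x(2) by (simp add: of_nat_eq_0_iff_char_dvd)
  then show ?thesis
    using assms(1) primes_dvd_imp_eq[of "CHAR('a)" l] by simp
qed

lemma coprime_CHAR_imp_coprime_CARD:
  assumes "coprime d CHAR('a::finite_field)"
  shows "coprime d CARD('a)"
proof (rule ccontr)
  assume "\<not> coprime d CARD('a)"
  then have "gcd d CARD('a) \<noteq> 1"
    using coprime_iff_gcd_eq_1[of d "CARD('a)"] by blast
  then obtain l where "prime l" "l dvd gcd d CARD('a)"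
    using prime_factor_nat by blast
  then have "prime l" "l dvd d" "l dvd CHAR('a)"
    using prime_dvd_CARD_finite_field[where ?'a = 'a] by auto
  with assms show False
    using coprime_common_divisor not_prime_unit by blast
qed

lemma CHAR_dvd_CARD_power:
  "r > 0 \<Longrightarrow> CHAR('a::finite_field) dvd CARD('a) ^ r"
  using CHAR_dvd_CARD by (rule dvd_trans) simp

text \<open>X^m - 1 splits into m linear factors. A repeated root would be a root of the derivative
  m X^(m-1), hence 0, which is not a root of unity.\<close>

lemma card_roots_of_unity_alg_closed:
  assumes "of_nat m \<noteq> (0 :: 'a::alg_closed_field)"
  shows "finite {x :: 'a. x ^ m = 1}" "card {x :: 'a. x ^ m = 1} = m"
proof -
  have m: "m > 0"
    using assms by (cases m) auto
  define f :: "'a poly" where "f = monom 1 m - 1"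
  have deg: "degree f = m"
    using m unfolding f_def by (subst diff_conv_add_uminus, subst degree_add_eq_left)
      (simp_all add: degree_monom_eq)
  with m have "f \<noteq> 0"
    by auto
  have roots: "{x. poly f x = 0} = {x. x ^ m = 1}"
    by (simp add: f_def poly_monom)
  show fin: "finite {x :: 'a. x ^ m = 1}"
    using poly_roots_finite[OF \<open>f \<noteq> 0\<close>] roots by simp
  obtain A c where A: "size A = degree f" "f = smult c (\<Prod>x\<in>#A. [:-x, 1:])"
    using alg_closed_imp_factorization[OF \<open>f \<noteq> 0\<close>] by blast
  have setA: "set_mset A = {x. x ^ m = 1}"
  proof -
    have "c \<noteq> 0"
      using A(2) \<open>f \<noteq> 0\<close> by auto
    then have "poly f x = 0 \<longleftrightarrow> x \<in># A" for x
      by (subst A(2)) (auto simp: poly_prod_mset prod_mset_zero_iff)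
    with roots show ?thesis
      by blast
  qed
  have "count A x = 1" if "x \<in># A" for x
  proof (rule ccontr)
    assume "count A x \<noteq> 1"
    with that have "2 \<le> count A x"
      using count_greater_zero_iff[of A x] by linarith
    then have "replicate_mset 2 x \<subseteq># A"
      by (simp add: count_le_replicate_mset_subset_eq)
    then obtain B where "A = replicate_mset 2 x + B"
      using mset_subset_eq_exists_conv by blast
    then have "A = add_mset x (add_mset x B)"
      by (simp add: numeral_2_eq_2)
    with A(2) have f: "f = [:-x, 1:] * ([:-x, 1:] * smult c (\<Prod>x\<in>#B. [:-x, 1:]))"
      by (simp add: mult_smult_right del: mult_pCons_left)
    have "poly (pderiv f) x = 0"
      by (subst f) (simp only: pderiv_mult poly_add poly_mult, simp)
    moreover have "pderiv f = monom (of_nat m) (m - 1)"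
      by (simp add: f_def pderiv_diff pderiv_monom)
    ultimately have "of_nat m * x ^ (m - 1) = 0"
      by (simp add: poly_monom)
    with assms have "x = 0"
      by (simp split: if_splits)
    with that setA m show False
      by (auto simp: power_0_left)
  qed
  then have "size A = card (set_mset A)"
    by (simp add: size_multiset_overloaded_eq)
  with A(1) deg setA show "card {x :: 'a. x ^ m = 1} = m"
    by simp
qed

text \<open>The solutions of x^d = 1 are sorted by their orders, the divisors of d. Both the numbers
  of elements of given order and the totients thus sum to d over these divisors, and induction on d
  identifies them. No generator of the group has to be chosen.\<close>

lemma (in group) card_elements_of_ord:
  assumes fin: "finite (carrier G)"
    and roots: "\<And>m. m dvd Coset.order G \<Longrightarrow> card {x \<in> carrier G. x [^] m = \<one>} = m"
    and "d dvd Coset.order G"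
  shows "card {x \<in> carrier G. group.ord G x = d} = totient d"
  using assms(3)
proof (induction d rule: less_induct)
  case (less d)
  have "d > 0"
    using less.prems fin order_gt_0_iff_finite by (metis dvd_0_left_iff gr0I not_less0)
  let ?N = "\<lambda>e. {x \<in> carrier G. group.ord G x = e}"
  have "{x \<in> carrier G. x [^] d = \<one>} = (\<Union>e\<in>{e. e dvd d}. ?N e)"
    by (auto simp: pow_eq_id)
  then have "d = card (\<Union>e\<in>{e. e dvd d}. ?N e)"
    using roots[OF less.prems] by simp
  also have "\<dots> = (\<Sum>e | e dvd d. card (?N e))"
    using fin \<open>d > 0\<close> by (intro card_UN_disjoint) auto
  also have "\<dots> = card (?N d) + (\<Sum>e\<in>{e. e dvd d} - {d}. card (?N e))"
    using \<open>d > 0\<close> by (subst sum.remove[of _ d]) auto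
  also have "(\<Sum>e\<in>{e. e dvd d} - {d}. card (?N e)) = (\<Sum>e\<in>{e. e dvd d} - {d}. totient e)"
  proof (rule sum.cong)
    fix e assume "e \<in> {e. e dvd d} - {d}"
    then show "card (?N e) = totient e"
      using \<open>d > 0\<close> dvd_imp_le[of e d] dvd_trans[OF _ less.prems, of e] by (intro less.IH) auto
  qed simp
  finally have "d = card (?N d) + (\<Sum>e\<in>{e. e dvd d} - {d}. totient e)" .
  moreover have "d = totient d + (\<Sum>e\<in>{e. e dvd d} - {d}. totient e)"
    using totient_divisor_sum[of d] \<open>d > 0\<close> by (subst (asm) sum.remove[of _ d]) auto
  ultimately show ?case
    by linarith
qed

section \<open>Unit groups of the finite subfields\<close>

lemma ext_units_simps [simp]:
  "carrier (ext_units r) = ext_field r - {0}" "x \<otimes>\<^bsub>ext_units r\<^esub> y = x * y" "\<one>\<^bsub>ext_units r\<^esub> = 1"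
  by (simp_all add: ext_units_def)

lemma zero_in_ext_field [simp]: "0 \<in> (ext_field r :: 'a::finite_field alg_closure set)"
  and one_in_ext_field [simp]: "1 \<in> (ext_field r :: 'a::finite_field alg_closure set)"
  by (simp_all add: ext_field_def power_0_left)

lemma mult_in_ext_field: "x \<in> ext_field r \<Longrightarrow> y \<in> ext_field r \<Longrightarrow> x * y \<in> ext_field r"
  and inverse_in_ext_field: "x \<in> ext_field r \<Longrightarrow> inverse x \<in> ext_field r"
  by (simp_all add: ext_field_def power_mult_distrib power_inverse)

lemma group_ext_units: "group (ext_units r :: 'a::finite_field alg_closure monoid)"
proof (rule groupI)
  fix x :: "'a alg_closure" assume "x \<in> carrier (ext_units r)"
  then show "\<exists>y\<in>carrier (ext_units r). y \<otimes>\<^bsub>ext_units r\<^esub> x = \<one>\<^bsub>ext_units r\<^esub>"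
    by (intro bexI[of _ "inverse x"]) (auto simp: inverse_in_ext_field)
qed (simp_all add: mult_in_ext_field mult.assoc)

lemma ext_units_pow [simp]: "x [^]\<^bsub>ext_units r\<^esub> (k :: nat) = x ^ k"
  by (induction k) (simp_all add: nat_pow_def mult.commute)

lemma CARD_finite_field_gt_1: "CARD('a::finite_field) > 1"
proof -
  have "card {0, 1 :: 'a} \<le> CARD('a)"
    by (intro card_mono) auto
  then show ?thesis
    by simp
qed

context
  fixes r :: nat
  assumes r: "r > 0"
begin

lemma ext_field_minus_0:
  "ext_field r - {0} = {x :: 'a::finite_field alg_closure. x ^ (CARD('a) ^ r - 1) = 1}"
proof -
  have *: "CARD('a) ^ r = Suc (CARD('a) ^ r - 1)"
    by simp
  have "x ^ (CARD('a) ^ r) = x * x ^ (CARD('a) ^ r - 1)" for x :: "'a alg_closure"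
    by (subst *) (rule power_Suc)
  \<comment> \<open>A zero exponent would admit x = 0 on the right, as 0^0 = 1.\<close>
  moreover have "CARD('a) ^ r - 1 \<noteq> 0"
    using one_less_power[OF CARD_finite_field_gt_1[where ?'a = 'a] r] by linarith
  ultimately show ?thesis
    by (auto simp: ext_field_def power_0_left)
qed

text \<open>The characteristic divides q^r, so it cannot divide q^r - 1 as well. Hence such an m is
  nonzero in the field and X^m - 1 is separable.\<close>

lemma not_CHAR_dvd: "m dvd CARD('a::finite_field) ^ r - 1 \<Longrightarrow> \<not> CHAR('a) dvd m"
proof
  assume "m dvd CARD('a) ^ r - 1" "CHAR('a) dvd m"
  then have "CHAR('a) dvd CARD('a) ^ r - 1"
    using dvd_trans by blast
  then have "CHAR('a) dvd 1"
    using dvd_diffD1[OF _ CHAR_dvd_CARD_power[OF r, where ?'a = 'a], of 1] by simp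
  then show False
    by simp
qed

lemma card_power_eq_1_ext_units:
  assumes "m dvd CARD('a::finite_field) ^ r - 1"
  shows "card {x \<in> carrier (ext_units r :: 'a alg_closure monoid). x [^]\<^bsub>ext_units r\<^esub> m = \<one>\<^bsub>ext_units r\<^esub>} = m"
proof -
  have "of_nat m \<noteq> (0 :: 'a alg_closure)"
    using not_CHAR_dvd[OF assms] by (simp add: of_nat_eq_0_iff_char_dvd)
  moreover have "{x \<in> carrier (ext_units r :: 'a alg_closure monoid). x [^]\<^bsub>ext_units r\<^esub> m = \<one>\<^bsub>ext_units r\<^esub>}
      = {x. x ^ m = 1}"
    using assms by (auto simp: ext_field_minus_0 power_mult elim!: dvdE)
  ultimately show ?thesis
    using card_roots_of_unity_alg_closed(2) by simp
qed

lemma card_ext_units: "card (carrier (ext_units r :: 'a::finite_field alg_closure monoid)) = CARD('a) ^ r - 1"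
  using card_power_eq_1_ext_units[where ?'a = 'a, OF dvd_refl]
  by (simp add: ext_field_minus_0)

lemma finite_ext_field: "finite (ext_field r :: 'a::finite_field alg_closure set)"
proof -
  \<comment> \<open>Infinite sets have \<open>card\<close> 0, so a positive cardinality proves
    finiteness.\<close>
  have "card (ext_field r - {0} :: 'a alg_closure set) > 0"
    using card_ext_units[where ?'a = 'a] one_less_power[OF CARD_finite_field_gt_1[where ?'a = 'a] r]
    by (simp del: One_nat_def)
  then have "finite (ext_field r - {0} :: 'a alg_closure set)"
    by (rule card_ge_0_finite)
  then show ?thesis
    by simp
qed

lemma card_ext_field: "card (ext_field r :: 'a::finite_field alg_closure set) = CARD('a) ^ r"
proof -
  have "card (ext_field r :: 'a alg_closure set) = Suc (card (ext_field r - {0} :: 'a alg_closure set))"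
    using finite_ext_field by (intro card.remove) auto
  also have "\<dots> = Suc (CARD('a) ^ r - 1)"
    using card_ext_units[where ?'a = 'a] by simp
  finally show ?thesis
    by simp
qed

lemma card_ext_units_of_ord:
  assumes "d dvd CARD('a::finite_field) ^ r - 1"
  shows "card {x \<in> carrier (ext_units r :: 'a alg_closure monoid). group.ord (ext_units r) x = d} = totient d"
proof -
  interpret group "ext_units r :: 'a alg_closure monoid"
    by (rule group_ext_units)
  have "Coset.order (ext_units r :: 'a alg_closure monoid) = CARD('a) ^ r - 1"
    unfolding Coset.order_def by (rule card_ext_units)
  then show ?thesis
    using assms finite_ext_field[where ?'a = 'a]
    by (intro card_elements_of_ord card_power_eq_1_ext_units) simp_all
qed

end

section \<open>Counting orbits\<close>

lemma power_in_ext_field: "x \<in> ext_field r \<Longrightarrow> x ^ k \<in> ext_field r"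
  by (induction k) (auto simp: mult_in_ext_field)

lemma weighted_action_apply:
  "x \<in> nonzero_vectors n r \<Longrightarrow> weighted_action n w r l x = (\<lambda>i\<in>{..n}. l ^ w i * x i)"
  by (simp add: weighted_action_def)

lemma weighted_action_closed:
  assumes "l \<in> ext_field r - {0}" "x \<in> nonzero_vectors n r"
  shows "weighted_action n w r l x \<in> nonzero_vectors n r"
  using assms unfolding weighted_action_apply[OF assms(2)]
  by (auto simp: nonzero_vectors_def mult_in_ext_field power_in_ext_field PiE_iff)

lemma weighted_action_mult:
  assumes "l \<in> ext_field r - {0}" "m \<in> ext_field r - {0}" "x \<in> nonzero_vectors n r"
  shows "weighted_action n w r (l * m) x = weighted_action n w r l (weighted_action n w r m x)"
  using assms weighted_action_closed[OF assms(2,3), of w]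
  by (auto simp: weighted_action_apply power_mult_distrib mult.assoc)

lemma weighted_action_one:
  assumes "x \<in> nonzero_vectors n r"
  shows "weighted_action n w r 1 x = x"
  using assms by (auto simp: weighted_action_apply nonzero_vectors_def PiE_iff extensional_def)

text \<open>The scalar 1/l provides the inverse bijection. Members of \<open>BijGroup\<close> are
  extensional, which explains the restriction built into \<open>weighted_action\<close>.\<close>

lemma group_action_weighted_action:
  "group_action (ext_units r :: 'a::finite_field alg_closure monoid) (nonzero_vectors n r)
     (weighted_action n w r)"
proof -
  let ?E = "nonzero_vectors n r :: (nat \<Rightarrow> 'a alg_closure) set"
  let ?\<phi> = "weighted_action n w r :: 'a alg_closure \<Rightarrow> _"
  have Bij: "?\<phi> l \<in> Bij ?E" if l: "l \<in> ext_field r - {0}" for l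
  proof -
    have il: "inverse l \<in> ext_field r - {0}"
      using l by (simp add: inverse_in_ext_field)
    have "bij_betw (?\<phi> l) ?E ?E"
    proof (rule bij_betwI[of _ _ _ "?\<phi> (inverse l)"])
      show "?\<phi> (inverse l) (?\<phi> l x) = x" "?\<phi> l (?\<phi> (inverse l) x) = x" if "x \<in> ?E" for x
        using l il that by (simp_all add: weighted_action_one flip: weighted_action_mult)
    qed (use weighted_action_closed l il in blast)+
    moreover have "?\<phi> l \<in> extensional ?E"
      by (simp add: weighted_action_def)
    ultimately show ?thesis
      by (simp add: Bij_def)
  qed
  have "?\<phi> (l * m) = compose ?E (?\<phi> l) (?\<phi> m)"
    if "l \<in> ext_field r - {0}" "m \<in> ext_field r - {0}" for l m
  proof (rule extensionalityI[of _ ?E])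
    show "?\<phi> (l * m) \<in> extensional ?E"
      by (simp add: weighted_action_def)
    show "?\<phi> (l * m) x = compose ?E (?\<phi> l) (?\<phi> m) x" if "x \<in> ?E" for x
      using that \<open>l \<in> _\<close> \<open>m \<in> _\<close> by (simp add: compose_eq weighted_action_mult)
  qed simp
  with Bij have "?\<phi> \<in> hom (ext_units r) (BijGroup ?E)"
    by (auto simp: hom_def BijGroup_def)
  then show ?thesis
    by (simp add: group_action_def group_hom_def group_hom_axioms_def group_ext_units group_BijGroup)
qed

lemma finite_nonzero_vectors:
  "r > 0 \<Longrightarrow> finite (nonzero_vectors n r :: (nat \<Rightarrow> 'a::finite_field alg_closure) set)"
  unfolding nonzero_vectors_def using finite_ext_field[where ?'a = 'a]
  by (intro finite_subset[OF _ finite_PiE[of "{..n}" "\<lambda>_. ext_field r"]]) auto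

text \<open>Coordinates of a fixed vector are independent: coordinate i ranges over the whole field
  if l^(w i) = 1 and is 0 otherwise. The subtracted 1 is the zero vector.\<close>

lemma card_invariants_weighted_action:
  fixes l :: "'a::finite_field alg_closure"
  assumes r: "r > 0"
  shows "card (invariants (nonzero_vectors n r) (weighted_action n w r) l)
       = (CARD('a) ^ r) ^ card {i. i \<le> n \<and> l ^ w i = 1} - 1"
proof -
  define B where "B i = (if l ^ w i = 1 then ext_field r else {0} :: 'a alg_closure set)" for i
  let ?z = "\<lambda>i\<in>{..n}. 0 :: 'a alg_closure"
  have fixed: "weighted_action n w r l x = x \<longleftrightarrow> (\<forall>i\<le>n. l ^ w i = 1 \<or> x i = 0)"
    if "x \<in> nonzero_vectors n r" for x
  proof -
    have "x = restrict x {..n}"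
      using that by (auto simp: nonzero_vectors_def PiE_iff extensional_restrict)
    then have "weighted_action n w r l x = x \<longleftrightarrow> (\<lambda>i\<in>{..n}. l ^ w i * x i) = restrict x {..n}"
      using that by (simp add: weighted_action_apply)
    also have "\<dots> \<longleftrightarrow> (\<forall>i\<le>n. l ^ w i * x i = x i)"
      by (auto simp: fun_eq_iff restrict_def)
    finally show ?thesis
      by auto
  qed
  have "invariants (nonzero_vectors n r) (weighted_action n w r) l = PiE {..n} B - {?z}"
  proof (intro equalityI subsetI)
    fix x assume "x \<in> invariants (nonzero_vectors n r) (weighted_action n w r) l"
    then have x: "x \<in> nonzero_vectors n r" "\<forall>i\<le>n. l ^ w i = 1 \<or> x i = 0"
      using fixed by (auto simp: invariants_def)
    then show "x \<in> PiE {..n} B - {?z}"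
      by (auto simp: nonzero_vectors_def PiE_iff B_def)
  next
    fix x assume x: "x \<in> PiE {..n} B - {?z}"
    have "\<exists>i\<le>n. x i \<noteq> 0"
    proof (rule ccontr)
      assume "\<not> ?thesis"
      with x have "x = ?z"
        by (intro extensionalityI[of _ "{..n}"]) (auto simp: PiE_iff)
      with x show False
        by simp
    qed
    moreover have "x i \<in> ext_field r \<and> (l ^ w i = 1 \<or> x i = 0)" if "i \<le> n" for i
    proof -
      have "x i \<in> B i"
        using x that by auto
      then show ?thesis
        by (auto simp: B_def split: if_splits)
    qed
    ultimately show "x \<in> invariants (nonzero_vectors n r) (weighted_action n w r) l"
      using fixed[of x] x by (auto simp: invariants_def nonzero_vectors_def PiE_iff)
  qed
  moreover have "?z \<in> PiE {..n} B"
    by (auto simp: B_def)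
  moreover have "finite (PiE {..n} B)"
    using finite_ext_field[OF r] by (intro finite_PiE) (auto simp: B_def)
  ultimately have "card (invariants (nonzero_vectors n r) (weighted_action n w r) l)
      = card (PiE {..n} B) - 1"
    by (simp add: card_Diff_singleton)
  also have "card (PiE {..n} B) = (\<Prod>i\<in>{..n}. card (B i))"
    by (simp add: card_PiE)
  also have "\<dots> = (\<Prod>i\<in>{..n}. if l ^ w i = 1 then CARD('a) ^ r else 1)"
    by (intro prod.cong) (auto simp: B_def card_ext_field[OF r])
  also have "\<dots> = (CARD('a) ^ r) ^ card {i. i \<le> n \<and> l ^ w i = 1}"
    by (simp add: prod.If_cases) (simp add: Int_def)
  finally show ?thesis .
qed

lemma power_diff_1_eq_nat:
  fixes Q :: nat
  assumes "Q > 0"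
  shows "Q ^ m - 1 = (Q - 1) * (\<Sum>j<m. Q ^ j)"
proof -
  have "int (Q ^ m - 1) = int Q ^ m - 1"
    using assms by (simp add: of_nat_diff)
  also have "\<dots> = (int Q - 1) * (\<Sum>j<m. int Q ^ j)"
    by (rule power_diff_1_eq)
  also have "\<dots> = int ((Q - 1) * (\<Sum>j<m. Q ^ j))"
    using assms by (simp add: of_nat_diff)
  finally show ?thesis
    by (simp only: of_nat_eq_iff)
qed

definition divisible_weights :: "nat \<Rightarrow> (nat \<Rightarrow> nat) \<Rightarrow> nat \<Rightarrow> nat" where
  "divisible_weights n w d = card {i. i \<le> n \<and> d dvd w i}"

lemma twist_count_eq:
  assumes r: "r > 0"
  shows "twist_count TYPE('a::finite_field) n w r =
    (\<Sum>d | d dvd CARD('a) ^ r - 1. totient d * (\<Sum>j<divisible_weights n w d. (CARD('a) ^ r) ^ j))"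
proof -
  let ?G = "ext_units r :: 'a alg_closure monoid"
  let ?Q = "CARD('a) ^ r"
  let ?ord = "group.ord ?G"
  let ?f = "\<lambda>d. \<Sum>j<divisible_weights n w d. ?Q ^ j"
  interpret group ?G
    by (rule group_ext_units)
  have Q: "?Q > 1"
    using CARD_finite_field_gt_1 r by (rule one_less_power)
  have fin: "finite (carrier ?G)"
    using finite_ext_field[OF r] by simp
  have order: "Coset.order ?G = ?Q - 1"
    unfolding Coset.order_def by (rule card_ext_units[OF r])
  have "twist_count TYPE('a) n w r * (?Q - 1)
      = (\<Sum>l\<in>carrier ?G. card (invariants (nonzero_vectors n r) (weighted_action n w r) l))"
    using group_action.burnside[OF group_action_weighted_action fin finite_nonzero_vectors[OF r]]
    by (simp only: twist_count_def order)
  \<comment> \<open>Each number of fixed points is the order of the group times a geometric sum, so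
    the division in Burnside's lemma can be carried out term by term.\<close>
  also have "\<dots> = (\<Sum>l\<in>carrier ?G. (?Q - 1) * ?f (?ord l))"
  proof (rule sum.cong)
    fix l assume l: "l \<in> carrier ?G"
    have "l ^ k = 1 \<longleftrightarrow> ?ord l dvd k" for k
      using pow_eq_id[OF l, of k] by simp
    then have "{i. i \<le> n \<and> l ^ w i = 1} = {i. i \<le> n \<and> ?ord l dvd w i}"
      by simp
    then show "card (invariants (nonzero_vectors n r) (weighted_action n w r) l) = (?Q - 1) * ?f (?ord l)"
      using Q unfolding card_invariants_weighted_action[OF r] divisible_weights_def
      by (simp only: power_diff_1_eq_nat[of ?Q])
  qed simp
  also have "\<dots> = (?Q - 1) * (\<Sum>l\<in>carrier ?G. ?f (?ord l))"
    by (simp only: sum_distrib_left)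
  \<comment> \<open>The summand depends only on the order of l, so the units are grouped by
    order.\<close>
  also have "(\<Sum>l\<in>carrier ?G. ?f (?ord l))
      = (\<Sum>d | d dvd ?Q - 1. \<Sum>l\<in>{l \<in> carrier ?G. ?ord l = d}. ?f (?ord l))"
    using Q fin ord_dvd_group_order by (intro sum.group[symmetric] finite_divisors_nat) (auto simp: order)
  also have "\<dots> = (\<Sum>d | d dvd ?Q - 1. totient d * ?f d)"
  proof (rule sum.cong)
    fix d assume "d \<in> {d. d dvd ?Q - 1}"
    then have "card {l \<in> carrier ?G. ?ord l = d} = totient d"
      by (intro card_ext_units_of_ord[OF r]) simp
    moreover have "(\<Sum>l\<in>{l \<in> carrier ?G. ?ord l = d}. ?f (?ord l)) = (\<Sum>l\<in>{l \<in> carrier ?G. ?ord l = d}. ?f d)"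
      by (intro sum.cong) auto
    ultimately show "(\<Sum>l\<in>{l \<in> carrier ?G. ?ord l = d}. ?f (?ord l)) = totient d * ?f d"
      by simp
  qed simp
  finally show ?thesis
    using Q by (simp add: mult.commute)
qed

text \<open>A line through the origin is an orbit for the weights 1 with the zero vector adjoined.
  No orbit contains that vector, so adjoining it is injective on orbits.\<close>

lemma projective_points_eq_twist_count:
  assumes r: "r > 0"
  shows "card (projective_points n r :: (nat \<Rightarrow> 'a::finite_field alg_closure) set set)
     = twist_count TYPE('a) n (\<lambda>_. 1) r"
proof -
  let ?G = "ext_units r :: 'a alg_closure monoid"
  let ?E = "nonzero_vectors n r :: (nat \<Rightarrow> 'a alg_closure) set"
  let ?orb = "orbit ?G (weighted_action n (\<lambda>_. 1) r)"
  let ?z = "\<lambda>i\<in>{..n}. 0 :: 'a alg_closure"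
  have z: "?z \<notin> ?E"
    by (auto simp: nonzero_vectors_def)
  have orbits: "orbits ?G ?E (weighted_action n (\<lambda>_. 1) r) = ?orb ` ?E"
    by (auto simp: orbits_def)
  have line: "(\<lambda>l. \<lambda>i\<in>{..n}. l * x i) ` ext_field r = insert ?z (?orb x)" if "x \<in> ?E" for x
  proof -
    have "?orb x = (\<lambda>l. \<lambda>i\<in>{..n}. l * x i) ` (ext_field r - {0})"
      using that by (auto simp: orbit_def weighted_action_apply)
    moreover have "(ext_field r :: 'a alg_closure set) = insert 0 (ext_field r - {0})"
      by auto
    then have "(\<lambda>l. \<lambda>i\<in>{..n}. l * x i) ` ext_field r
        = insert ?z ((\<lambda>l. \<lambda>i\<in>{..n}. l * x i) ` (ext_field r - {0}))"
      by (metis (no_types, lifting) image_insert mult_zero_left restrict_ext)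
    ultimately show ?thesis
      by simp
  qed
  have "projective_points n r = insert ?z ` (?orb ` ?E)"
    unfolding projective_points_def image_image using line by (rule image_cong[OF refl])
  moreover have "inj_on (insert ?z) (?orb ` ?E)"
  proof (rule inj_onI)
    fix A B assume "A \<in> ?orb ` ?E" "B \<in> ?orb ` ?E" and eq: "insert ?z A = insert ?z B"
    then have "A \<subseteq> ?E" "B \<subseteq> ?E"
      by (auto simp: orbit_def weighted_action_closed)
    with z have "?z \<notin> A" "?z \<notin> B"
      by (metis subsetD)+
    with eq show "A = B"
      by (simp add: insert_ident)
  qed
  ultimately show ?thesis
    by (simp add: card_image twist_count_def orbits del: One_nat_def)
qed

section \<open>The multiset of eigenvalues\<close>

lemma sum_mset_image_sum:
  "finite A \<Longrightarrow> (\<Sum>x\<in>#sum g A. f x) = (\<Sum>a\<in>A. \<Sum>x\<in>#g a. f x)"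
  by (induction A rule: finite_induct) auto

lemma image_mset_sum_set:
  "finite A \<Longrightarrow> image_mset f (sum g A) = (\<Sum>a\<in>A. image_mset f (g a))"
  by (induction A rule: finite_induct) auto

lemma size_filter_mset_sum:
  "finite A \<Longrightarrow> size (filter_mset P (sum g A)) = (\<Sum>a\<in>A. size (filter_mset P (g a)))"
  by (induction A rule: finite_induct) auto

text \<open>An index set independent of r for the sum giving the orbit counts: divisors of q^r - 1
  are prime to p, and those dividing no weight contribute an empty geometric sum.\<close>

definition prime_to_weight_divisors :: "nat \<Rightarrow> nat \<Rightarrow> (nat \<Rightarrow> nat) \<Rightarrow> nat set" where
  "prime_to_weight_divisors p n w = {d. coprime d p \<and> (\<exists>i\<le>n. d dvd w i)}"

text \<open>The \<open>o\<close>-th roots of unity, where \<open>o\<close> is the order of \<open>q\<close> modulo \<open>d\<close>, each with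
  multiplicity \<open>\<phi>(d) / o\<close>.\<close>

definition unit_eigenvalues :: "nat \<Rightarrow> nat \<Rightarrow> complex multiset" where
  "unit_eigenvalues q d =
     image_mset (\<lambda>k. cis (2 * pi * real k / real (ord d q))) (mset_set {..<totient d})"

text \<open>In the r-th power sum the roots of unity detect whether d divides q^r - 1, and the
  powers of q produce the geometric sum attached to d.\<close>

definition eigenvalues :: "nat \<Rightarrow> nat \<Rightarrow> nat \<Rightarrow> (nat \<Rightarrow> nat) \<Rightarrow> complex multiset" where
  "eigenvalues p q n w =
     (\<Sum>d\<in>prime_to_weight_divisors p n w. \<Sum>j<divisible_weights n w d.
        image_mset (\<lambda>a. a * of_nat q ^ j) (unit_eigenvalues q d))"

lemma size_unit_eigenvalues [simp]: "size (unit_eigenvalues q d) = totient d"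
  by (simp add: unit_eigenvalues_def)

lemma norm_unit_eigenvalues: "a \<in># unit_eigenvalues q d \<Longrightarrow> norm a = 1"
  by (auto simp: unit_eigenvalues_def)

lemma cis_eq_1_iff: "cis x = 1 \<longleftrightarrow> (\<exists>k::int. x = of_int k * 2 * pi)"
proof -
  have "sin x = 0" if "cos x = 1"
    using that sin_cos_squared_add[of x] by simp
  then show ?thesis
    by (auto simp: complex_eq_iff simp flip: cos_one_2pi_int)
qed

lemma cis_multiple_2pi_nat [simp]: "cis (2 * pi * real k) = 1"
  unfolding cis_eq_1_iff by (intro exI[of _ "int k"]) simp

lemma unit_eigenvalues_root_of_unity:
  assumes "a \<in># unit_eigenvalues q d" "coprime d q"
  shows "a ^ ord d q = 1"
proof -
  have "ord d q > 0"
    using assms(2) by simp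
  obtain k where "a = cis (2 * pi * real k / real (ord d q))"
    using assms(1) by (auto simp: unit_eigenvalues_def)
  then have "a ^ ord d q = cis (2 * pi * real k)"
    using \<open>ord d q > 0\<close> by (simp add: Complex.DeMoivre)
  also have "\<dots> = 1"
    by simp
  finally show ?thesis .
qed

text \<open>A geometric sum in \<open>z\<close> with \<open>totient d\<close> terms. The order of q
  modulo d divides \<open>totient d\<close>, so the sum vanishes unless z = 1, which means that the
  order divides r.\<close>

lemma power_sum_unit_eigenvalues:
  assumes cop: "coprime d q" and q: "q > 0"
  shows "(\<Sum>a\<in>#unit_eigenvalues q d. a ^ r) = (if d dvd q ^ r - 1 then of_nat (totient d) else 0)"
proof -
  define o' where "o' = ord d q"
  have o': "o' > 0"
    using cop by (simp add: o'_def)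
  define z where "z = cis (2 * pi * real r / real o')"
  have z1: "z = 1 \<longleftrightarrow> o' dvd r"
  proof -
    have "z = 1 \<longleftrightarrow> (\<exists>k::int. 2 * pi * real r / real o' = of_int k * 2 * pi)"
      unfolding z_def by (rule cis_eq_1_iff)
    also have "\<dots> \<longleftrightarrow> (\<exists>k::int. real r = of_int (k * int o'))"
      using o' by (simp add: field_simps)
    also have "\<dots> \<longleftrightarrow> (\<exists>k::int. int r = k * int o')"
      by (metis of_int_eq_iff of_int_of_nat_eq)
    also have "\<dots> \<longleftrightarrow> int o' dvd int r"
      by (auto simp: dvd_def mult.commute)
    finally show ?thesis
      by simp
  qed
  have "d dvd q ^ r - 1 \<longleftrightarrow> [q ^ r = 1] (mod d)"
    using q cong_altdef_nat[of 1 "q ^ r" d] by simp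
  also have "\<dots> \<longleftrightarrow> o' dvd r"
    unfolding o'_def by (rule ord_divides)
  finally have dvd: "d dvd q ^ r - 1 \<longleftrightarrow> z = 1"
    by (simp add: z1)
  have "(\<Sum>a\<in>#unit_eigenvalues q d. a ^ r) = (\<Sum>k<totient d. z ^ k)"
    by (simp add: unit_eigenvalues_def sum_unfold_sum_mset image_mset.compositionality comp_def
        Complex.DeMoivre z_def o'_def mult_ac)
  also have "\<dots> = (if z = 1 then of_nat (totient d) else 0)"
  proof -
    obtain m where "totient d = o' * m"
      using cop order_divides_totient[of d q] by (auto simp: o'_def coprime_commute elim: dvdE)
    then have "z ^ totient d = (cis (2 * pi * real r)) ^ m"
      using o' by (simp add: z_def power_mult Complex.DeMoivre)
    also have "cis (2 * pi * real r) = 1"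
      by simp
    finally show ?thesis
      by (simp add: geometric_sum)
  qed
  finally show ?thesis
    using dvd by simp
qed

text \<open>Inversion is k \<mapsto> -k on the indices modulo \<open>totient d\<close>; this is
  compatible with the roots because the order of q divides \<open>totient d\<close>.\<close>

lemma inverse_unit_eigenvalues:
  assumes cop: "coprime d q"
  shows "image_mset inverse (unit_eigenvalues q d) = unit_eigenvalues q d"
proof -
  define o' where "o' = ord d q"
  have o': "o' > 0"
    using cop by (simp add: o'_def)
  define t where "t = totient d"
  obtain m where t: "t = o' * m"
    using cop order_divides_totient[of d q] by (auto simp: t_def o'_def coprime_commute elim: dvdE)
  let ?f = "\<lambda>k. cis (2 * pi * real k / real o')"
  \<comment> \<open>The reduction modulo t matters only for k = 0, where t - k lies just outside the
    index range.\<close>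
  let ?g = "\<lambda>k. (t - k) mod t"
  have bij: "bij_betw ?g {..<t} {..<t}"
  proof (rule bij_betwI[of _ _ _ ?g])
    show "?g (?g k) = k" if "k \<in> {..<t}" for k
      using that by (cases "k = 0") auto
    then show "?g (?g k) = k" if "k \<in> {..<t}" for k
      using that by blast
  qed auto
  have f: "inverse (?f k) = ?f (?g k)" if "k < t" for k
  proof (cases "k = 0")
    case False
    then have g: "?g k = t - k"
      using that by simp
    have "?f k * ?f (t - k) = cis (2 * pi * real t / real o')"
      using that by (simp add: cis_mult of_nat_diff diff_divide_distrib right_diff_distrib)
    also have "2 * pi * real t / real o' = 2 * pi * real m"
      using o' by (simp add: t)
    also have "cis \<dots> = 1"
      by simp
    finally show ?thesis
      unfolding g by (rule inverse_unique)
  qed simp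
  have "image_mset inverse (unit_eigenvalues q d) = image_mset (\<lambda>k. ?f (?g k)) (mset_set {..<t})"
    unfolding unit_eigenvalues_def image_mset.compositionality comp_def o'_def[symmetric] t_def[symmetric]
    using f by (intro image_mset_cong) simp
  also have "\<dots> = image_mset ?f (image_mset ?g (mset_set {..<t}))"
    by (simp add: image_mset.compositionality comp_def)
  also have "image_mset ?g (mset_set {..<t}) = mset_set {..<t}"
    using bij by (simp add: image_mset_mset_set bij_betw_def)
  finally show ?thesis
    by (simp add: unit_eigenvalues_def o'_def t_def)
qed

lemma unit_eigenvalues_1: "unit_eigenvalues q 1 = {#1#}"
  by (simp add: unit_eigenvalues_def lessThan_Suc)

context
  fixes p n :: nat and w :: "nat \<Rightarrow> nat"
  assumes w: "\<forall>i\<le>n. w i > 0"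
begin

lemma finite_prime_to_weight_divisors: "finite (prime_to_weight_divisors p n w)"
proof (rule finite_subset)
  show "prime_to_weight_divisors p n w \<subseteq> (\<Union>i\<le>n. {d. d dvd w i})"
    by (auto simp: prime_to_weight_divisors_def)
  show "finite (\<Union>i\<le>n. {d. d dvd w i})"
    using w by auto
qed

text \<open>Roots of unity have norm 1 and the powers of q are distinct, so the circle of radius q^j
  meets only the layer with exponent j. A divisor d has such a layer iff more than j weights are
  divisible by d.\<close>

lemma size_filter_norm_eigenvalues:
  assumes q: "q > 1"
  shows "size {#a \<in># eigenvalues p q n w. norm a = real q ^ j#}
     = (\<Sum>d\<in>prime_to_weight_divisors p n w. if j < divisible_weights n w d then totient d else 0)"
proof -
  have *: "size {#a \<in># image_mset (\<lambda>a. a * of_nat q ^ i) (unit_eigenvalues q d). norm a = real q ^ j#}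
      = (if i = j then totient d else 0)" for i d
  proof -
    have "{#a \<in># image_mset (\<lambda>a. a * of_nat q ^ i) (unit_eigenvalues q d). norm a = real q ^ j#}
      = {#a \<in># image_mset (\<lambda>a. a * of_nat q ^ i) (unit_eigenvalues q d). i = j#}"
      using q by (intro filter_mset_cong)
        (auto simp: norm_mult norm_power norm_unit_eigenvalues power_inject_exp)
    then show ?thesis
      by simp
  qed
  show ?thesis
    unfolding eigenvalues_def
    by (simp add: size_filter_mset_sum finite_prime_to_weight_divisors *)
qed

lemma eigenvalues_form:
  assumes "a \<in># eigenvalues p q n w" and cop: "\<And>d. coprime d p \<Longrightarrow> coprime d q"
  shows "\<exists>\<zeta> m j. m > 0 \<and> \<zeta> ^ m = 1 \<and> j \<le> n \<and> a = \<zeta> * of_nat q ^ j"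
proof -
  obtain d j \<zeta> where d: "d \<in> prime_to_weight_divisors p n w" "j < divisible_weights n w d"
    "\<zeta> \<in># unit_eigenvalues q d" "a = \<zeta> * of_nat q ^ j"
    using assms(1) by (auto simp: eigenvalues_def set_mset_sum finite_prime_to_weight_divisors)
  have "divisible_weights n w d \<le> card {..n}"
    unfolding divisible_weights_def by (intro card_mono) auto
  moreover have "coprime d q"
    using d(1) cop by (auto simp: prime_to_weight_divisors_def)
  ultimately show ?thesis
    using d(2,4) unit_eigenvalues_root_of_unity[OF d(3)]
    by (intro exI[of _ \<zeta>] exI[of _ "ord d q"] exI[of _ j]) auto
qed

text \<open>If each d divides all weights, it carries every layer from 0 to n. The reflection
  exchanges the layers j and n - j and inverts the roots of unity, which permutes each layer's
  roots.\<close>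

lemma reflect_eigenvalues:
  assumes full: "\<And>d. d \<in> prime_to_weight_divisors p n w \<Longrightarrow> divisible_weights n w d = Suc n"
    and cop: "\<And>d. coprime d p \<Longrightarrow> coprime d q" and q: "q > 0"
  shows "image_mset (\<lambda>a. of_nat (q ^ n) / a) (eigenvalues p q n w) = eigenvalues p q n w"
proof -
  let ?D = "prime_to_weight_divisors p n w"
  let ?U = "\<lambda>j d. image_mset (\<lambda>a. a * of_nat q ^ j) (unit_eigenvalues q d)"
  have *: "image_mset (\<lambda>a. of_nat (q ^ n) / a) (?U j d) = ?U (n - j) d"
    if "d \<in> ?D" "j < Suc n" for j d
  proof -
    have "(of_nat q :: complex) ^ n = of_nat q ^ j * of_nat q ^ (n - j)"
      using that(2) by (simp flip: power_add)
    then have "of_nat (q ^ n) / (a * of_nat q ^ j) = inverse a * of_nat q ^ (n - j)" for a :: complex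
      using q by (simp add: field_simps)
    then have "image_mset (\<lambda>a. of_nat (q ^ n) / a) (?U j d)
        = image_mset (\<lambda>a. a * of_nat q ^ (n - j)) (image_mset inverse (unit_eigenvalues q d))"
      by (simp add: image_mset.compositionality comp_def)
    also have "\<dots> = ?U (n - j) d"
      using that(1) cop by (subst inverse_unit_eigenvalues) (auto simp: prime_to_weight_divisors_def)
    finally show ?thesis .
  qed
  have "image_mset (\<lambda>a. of_nat (q ^ n) / a) (eigenvalues p q n w)
      = (\<Sum>d\<in>?D. \<Sum>j<divisible_weights n w d. image_mset (\<lambda>a. of_nat (q ^ n) / a) (?U j d))"
    unfolding eigenvalues_def
    by (simp only: image_mset_sum_set finite_prime_to_weight_divisors finite_lessThan)
  \<comment> \<open>The exponent n - j is written in the form that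
    \<open>sum.nat_diff_reindex\<close> expects.\<close>
  also have "\<dots> = (\<Sum>d\<in>?D. \<Sum>j<Suc n. ?U (Suc n - Suc j) d)"
    using * full by (intro sum.cong) auto
  also have "\<dots> = (\<Sum>d\<in>?D. \<Sum>j<Suc n. ?U j d)"
    by (intro sum.cong refl sum.nat_diff_reindex)
  also have "\<dots> = eigenvalues p q n w"
    unfolding eigenvalues_def using full by (intro sum.cong) auto
  finally show ?thesis .
qed

text \<open>The right-hand sum is bounded by the left-hand one term by term, so equal sums force
  equal terms. Each d divides some weight and has a positive totient, so its left-hand term is
  nonzero.\<close>

lemma sum_if_divisible_weights_eq_iff:
  "(\<Sum>d\<in>prime_to_weight_divisors p n w. if 0 < divisible_weights n w d then totient d else 0) =
   (\<Sum>d\<in>prime_to_weight_divisors p n w. if n < divisible_weights n w d then totient d else 0) \<longleftrightarrow>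
   (\<forall>d\<in>prime_to_weight_divisors p n w. divisible_weights n w d = Suc n)"
  (is "sum ?f ?D = sum ?g ?D \<longleftrightarrow> _")
proof -
  have le: "divisible_weights n w d \<le> Suc n" for d
  proof -
    have "divisible_weights n w d \<le> card {..n}"
      unfolding divisible_weights_def by (intro card_mono) auto
    then show ?thesis
      by simp
  qed
  have pos: "divisible_weights n w d > 0" "totient d > 0" if d: "d \<in> ?D" for d
  proof -
    obtain i where i: "i \<le> n" "d dvd w i"
      using d by (auto simp: prime_to_weight_divisors_def)
    then show "divisible_weights n w d > 0"
      by (auto simp: divisible_weights_def card_gt_0_iff)
    show "totient d > 0"
      using i w dvd_pos_nat[of "w i" d] by simp
  qed
  have "sum ?f ?D = sum ?g ?D \<longleftrightarrow> (\<forall>d\<in>?D. ?f d = ?g d)"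
  proof
    assume "sum ?f ?D = sum ?g ?D"
    then show "\<forall>d\<in>?D. ?f d = ?g d"
      using sum_mono_inv[of ?g ?D ?f] finite_prime_to_weight_divisors pos by auto
  qed (auto intro!: sum.cong)
  also have "\<dots> \<longleftrightarrow> (\<forall>d\<in>?D. divisible_weights n w d = Suc n)"
  proof (intro ball_cong refl)
    fix d assume "d \<in> ?D"
    then show "?f d = ?g d \<longleftrightarrow> divisible_weights n w d = Suc n"
      using le[of d] pos[of d] by auto
  qed
  finally show ?thesis .
qed

lemma divisible_weights_full_iff: "divisible_weights n w d = Suc n \<longleftrightarrow> (\<forall>i\<le>n. d dvd w i)"
proof -
  have "divisible_weights n w d = card {..n} \<longleftrightarrow> {i. i \<le> n \<and> d dvd w i} = {..n}"
    unfolding divisible_weights_def using card_subset_eq[of "{..n}" "{i. i \<le> n \<and> d dvd w i}"] by auto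
  then show ?thesis
    by auto
qed

end

section \<open>Prime-to-p parts of the weights\<close>

context
  fixes p :: nat
  assumes p: "prime p"
begin

lemma prime_to_part_decompose:
  assumes "x > 0"
  shows "x = p ^ multiplicity p x * prime_to_part p x" "coprime (prime_to_part p x) p"
proof -
  show 1: "x = p ^ multiplicity p x * prime_to_part p x"
    by (simp add: prime_to_part_def multiplicity_dvd)
  have "\<not> p dvd prime_to_part p x"
    using assms p not_prime_unit multiplicity_decompose[of x p] unfolding prime_to_part_def by blast
  then show "coprime (prime_to_part p x) p"
    using p by (simp add: prime_imp_coprime coprime_commute)
qed

lemma coprime_dvd_prime_to_part_iff:
  assumes "x > 0" "coprime d p"
  shows "d dvd prime_to_part p x \<longleftrightarrow> d dvd x"
proof -
  have "coprime d (p ^ multiplicity p x)"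
    using assms(2) by simp
  then show ?thesis
    by (subst (2) prime_to_part_decompose(1)[OF assms(1)]) (simp add: coprime_dvd_mult_right_iff)
qed

lemma prime_to_part_power: "prime_to_part p (p ^ k) = 1"
  using p by (simp add: prime_to_part_def)

text \<open>The prime-to-p part of \<open>w i\<close> is itself one of the divisors d, so it divides
  every \<open>w j\<close> and hence its prime-to-p part; exchanging i and j gives equality.
  Conversely, a d prime to p sees only the prime-to-p parts.\<close>

lemma prime_to_weight_divisors_full_iff:
  assumes w: "\<forall>i\<le>n. w i > 0"
  shows "(\<forall>d\<in>prime_to_weight_divisors p n w. \<forall>i\<le>n. d dvd w i) \<longleftrightarrow>
    (\<forall>i\<le>n. \<forall>j\<le>n. prime_to_part p (w i) = prime_to_part p (w j))"
proof safe
  fix i j assume full: "\<forall>d\<in>prime_to_weight_divisors p n w. \<forall>i\<le>n. d dvd w i" and ij: "i \<le> n" "j \<le> n"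
  have "prime_to_part p (w i) dvd prime_to_part p (w j)" if "i \<le> n" "j \<le> n" for i j
  proof -
    have cop: "coprime (prime_to_part p (w i)) p"
      using w that prime_to_part_decompose(2) by blast
    then have "prime_to_part p (w i) \<in> prime_to_weight_divisors p n w"
      using w that coprime_dvd_prime_to_part_iff[OF _ cop, of "w i"]
      by (auto simp: prime_to_weight_divisors_def)
    with full that have "prime_to_part p (w i) dvd w j"
      by blast
    with cop w that show ?thesis
      by (simp add: coprime_dvd_prime_to_part_iff)
  qed
  with ij show "prime_to_part p (w i) = prime_to_part p (w j)"
    by (simp add: dvd_antisym)
next
  fix d j assume eq: "\<forall>i\<le>n. \<forall>j\<le>n. prime_to_part p (w i) = prime_to_part p (w j)"
    and "d \<in> prime_to_weight_divisors p n w" and j: "j \<le> n"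
  then obtain i where "coprime d p" "i \<le> n" "d dvd w i"
    by (auto simp: prime_to_weight_divisors_def)
  with eq w j show "d dvd w j"
    by (metis coprime_dvd_prime_to_part_iff)
qed

lemma prime_to_weight_divisors_const:
  assumes w: "\<forall>i\<le>n. w i > 0" and c: "\<forall>i\<le>n. prime_to_part p (w i) = c"
  shows "prime_to_weight_divisors p n w = {d. d dvd c}"
proof (intro equalityI subsetI)
  fix d assume "d \<in> prime_to_weight_divisors p n w"
  then obtain i where "coprime d p" "i \<le> n" "d dvd w i"
    by (auto simp: prime_to_weight_divisors_def)
  with w c show "d \<in> {d. d dvd c}"
    by (metis coprime_dvd_prime_to_part_iff mem_Collect_eq)
next
  fix d assume "d \<in> {d. d dvd c}"
  then have d: "d dvd prime_to_part p (w 0)"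
    using c by simp
  moreover have "coprime (prime_to_part p (w 0)) p" "w 0 > 0"
    using w prime_to_part_decompose(2) by auto
  ultimately have "coprime d p"
    using coprime_divisors[OF d dvd_refl] by blast
  with d \<open>w 0 > 0\<close> show "d \<in> prime_to_weight_divisors p n w"
    by (auto simp: prime_to_weight_divisors_def coprime_dvd_prime_to_part_iff)
qed

end

section \<open>The twist zeta function and its spectrum in terms of eigenvalues\<close>

lemma power_commute_exponents: "(x ^ j) ^ r = (x ^ r) ^ j" for x :: "'a::monoid_mult"
  by (simp add: mult.commute flip: power_mult)

lemma twist_count_eq_power_sum:
  assumes w: "\<forall>i\<le>n. w i > 0" and r: "r > 0"
  shows "of_nat (twist_count TYPE('a::finite_field) n w r)
    = (\<Sum>a\<in>#eigenvalues CHAR('a) CARD('a) n w. a ^ r)"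
proof -
  let ?q = "CARD('a)" and ?D = "prime_to_weight_divisors CHAR('a) n w"
  let ?h = "\<lambda>d. of_nat (totient d) * (\<Sum>j<divisible_weights n w d. (of_nat ?q ^ r) ^ j) :: complex"
  note fin = finite_prime_to_weight_divisors[OF w, of "CHAR('a)"]
  have Q: "?q ^ r > 1"
    using CARD_finite_field_gt_1 r by (rule one_less_power)
  have "(\<Sum>a\<in>#eigenvalues CHAR('a) ?q n w. a ^ r)
      = (\<Sum>d\<in>?D. \<Sum>j<divisible_weights n w d.
          (\<Sum>a\<in>#unit_eigenvalues ?q d. a ^ r) * (of_nat ?q ^ j) ^ r)"
    unfolding eigenvalues_def
    by (simp add: sum_mset_image_sum fin image_mset.compositionality comp_def power_mult_distrib
        sum_mset_distrib_right)
  also have "\<dots> = (\<Sum>d\<in>?D. if d dvd ?q ^ r - 1 then ?h d else 0)"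
  proof (rule sum.cong)
    fix d assume "d \<in> ?D"
    then have "coprime d ?q"
      using coprime_CHAR_imp_coprime_CARD by (auto simp: prime_to_weight_divisors_def)
    then show "(\<Sum>j<divisible_weights n w d. (\<Sum>a\<in>#unit_eigenvalues ?q d. a ^ r) * (of_nat ?q ^ j) ^ r)
        = (if d dvd ?q ^ r - 1 then ?h d else 0)"
      by (simp add: power_sum_unit_eigenvalues sum_distrib_left power_commute_exponents[of _ _ r])
  qed simp
  also have "\<dots> = (\<Sum>d\<in>{d \<in> ?D. d dvd ?q ^ r - 1}. ?h d)"
    by (rule sum.inter_filter[OF fin, symmetric])
  \<comment> \<open>The added divisors are prime to the characteristic, so being outside
    \<open>?D\<close> they divide no weight, and their geometric sums are empty.\<close>
  also have "\<dots> = (\<Sum>d | d dvd ?q ^ r - 1. ?h d)"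
  proof (rule sum.mono_neutral_left)
    show "\<forall>d\<in>{d. d dvd ?q ^ r - 1} - {d \<in> ?D. d dvd ?q ^ r - 1}. ?h d = 0"
    proof
      fix d assume d: "d \<in> {d. d dvd ?q ^ r - 1} - {d \<in> ?D. d dvd ?q ^ r - 1}"
      then have "\<not> CHAR('a) dvd d"
        by (intro not_CHAR_dvd[OF r]) simp
      then have "coprime d CHAR('a)"
        using prime_imp_coprime[OF CHAR_prime] by (simp add: coprime_commute)
      with d have "{i. i \<le> n \<and> d dvd w i} = {}"
        by (auto simp: prime_to_weight_divisors_def)
      then have "divisible_weights n w d = 0"
        by (simp only: divisible_weights_def card.empty)
      then show "?h d = 0"
        by simp
    qed
  qed (use Q in \<open>auto intro: finite_divisors_nat\<close>)
  also have "\<dots> = of_nat (twist_count TYPE('a) n w r)"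
    by (simp add: twist_count_eq[OF r])
  finally show ?thesis ..
qed

lemma twist_zeta_mult_reciprocal_poly:
  assumes "\<forall>i\<le>n. w i > 0"
  shows "twist_zeta TYPE('a::finite_field) n w *
    fps_of_poly (reciprocal_poly (eigenvalues CHAR('a) CARD('a) n w)) = 1"
  unfolding twist_zeta_def using assms
  by (intro zeta_of_counts_mult_reciprocal_poly twist_count_eq_power_sum)

lemma zero_notin_eigenvalues:
  assumes "\<forall>i\<le>n. w i > 0"
  shows "0 \<notin># eigenvalues CHAR('a::finite_field) CARD('a) n w"
proof
  assume "0 \<in># eigenvalues CHAR('a) CARD('a) n w"
  from eigenvalues_form[OF assms this coprime_CHAR_imp_coprime_CARD]
  obtain \<zeta> :: complex and m j where "m > 0" "\<zeta> ^ m = 1" "0 = \<zeta> * of_nat CARD('a) ^ j"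
    by blast
  then show False
    by (auto simp: power_0_left)
qed

lemma multiplicity_spectrum_eq_size:
  assumes w: "\<forall>i\<le>n. w i > 0"
  shows "multiplicity_spectrum TYPE('a::finite_field) n w j
    = int (size {#a \<in># eigenvalues CHAR('a) CARD('a) n w. norm a = real CARD('a) ^ j#})"
proof -
  let ?M = "eigenvalues CHAR('a) CARD('a) n w"
  have "zeta_factorization CARD('a) n (twist_zeta TYPE('a) n w) b \<longleftrightarrow> b = (\<lambda>a. int (count ?M a))" for b
    using eigenvalues_form[OF w _ coprime_CHAR_imp_coprime_CARD] twist_zeta_mult_reciprocal_poly[OF w]
    by (intro zeta_factorization_iff) auto
  then have b: "twist_exponent TYPE('a) n w = (\<lambda>a. int (count ?M a))"
    by (simp add: twist_exponent_def)
  have "multiplicity_spectrum TYPE('a) n w j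
      = int (\<Sum>a | a \<in># ?M \<and> norm a = real CARD('a) ^ j. count ?M a)"
    by (simp add: multiplicity_spectrum_def b count_eq_zero_iff)
  also have "(\<Sum>a | a \<in># ?M \<and> norm a = real CARD('a) ^ j. count ?M a)
      = size {#a \<in># ?M. norm a = real CARD('a) ^ j#}"
    by (simp add: size_multiset_overloaded_eq)
  finally show ?thesis .
qed

lemma projective_zeta_eq_twist_zeta:
  "projective_zeta TYPE('a::finite_field) n = twist_zeta TYPE('a) n (\<lambda>_. 1)"
proof -
  have "Abs_fps (\<lambda>r. if r = 0 then 0 else of_nat (card (projective_points n r :: (nat \<Rightarrow> 'a alg_closure) set set)) / of_nat r)
    = Abs_fps (\<lambda>r. if r = 0 then 0 else of_nat (twist_count TYPE('a) n (\<lambda>_. 1) r) / of_nat r :: complex)"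
    by (rule fps_ext) (simp add: projective_points_eq_twist_count)
  then show ?thesis
    by (simp add: projective_zeta_def twist_zeta_def zeta_of_counts_def del: One_nat_def)
qed

text \<open>All prime-to-p parts are 1, so only d = 1 occurs. It divides every weight, and the
  eigenvalues are 1, q, ..., q^n, once each.\<close>

lemma twist_zeta_prime_power_weights:
  assumes w: "\<forall>i\<le>n. \<exists>k. w i = CHAR('a::finite_field) ^ k"
  shows "twist_zeta TYPE('a) n w = (\<Prod>j\<le>n. inverse (1 - fps_const (of_nat CARD('a) ^ j) * fps_X))"
proof -
  let ?L = "\<lambda>j. 1 - fps_const (of_nat CARD('a) ^ j) * fps_X :: complex fps"
  have pos: "\<forall>i\<le>n. w i > 0"
    using w by (metis CHAR_pos zero_less_power)
  have "\<forall>i\<le>n. prime_to_part CHAR('a) (w i) = 1"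
    using w prime_to_part_power[OF CHAR_prime] by metis
  then have D: "prime_to_weight_divisors CHAR('a) n w = {1}"
    using prime_to_weight_divisors_const[OF CHAR_prime pos, of 1] by simp
  have "divisible_weights n w 1 = Suc n"
    using divisible_weights_full_iff[OF pos] by simp
  then have "eigenvalues CHAR('a) CARD('a) n w = (\<Sum>j<Suc n. {#of_nat CARD('a) ^ j#})"
    by (simp add: eigenvalues_def D unit_eigenvalues_1 del: One_nat_def sum.lessThan_Suc)
  then have "reciprocal_poly (eigenvalues CHAR('a) CARD('a) n w) = (\<Prod>j\<le>n. [:1, - (of_nat CARD('a) ^ j):])"
    by (simp add: reciprocal_poly_sum lessThan_Suc_atMost del: sum.lessThan_Suc sum.atMost_Suc)
  then have "fps_of_poly (reciprocal_poly (eigenvalues CHAR('a) CARD('a) n w)) = (\<Prod>j\<le>n. ?L j)"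
    by (simp add: fps_of_poly_prod fps_of_poly_pCons mult.commute[of fps_X] flip: fps_const_neg)
  then have Z: "twist_zeta TYPE('a) n w * (\<Prod>j\<le>n. ?L j) = 1"
    using twist_zeta_mult_reciprocal_poly[OF pos, where ?'a = 'a] by simp
  have "(\<Prod>j\<le>n. ?L j) * (\<Prod>j\<le>n. inverse (?L j)) = 1"
    by (simp add: inverse_mult_eq_1' flip: prod.distrib)
  then have "twist_zeta TYPE('a) n w * (\<Prod>j\<le>n. ?L j) * (\<Prod>j\<le>n. inverse (?L j)) = twist_zeta TYPE('a) n w"
    by (simp only: mult.assoc mult_1_right)
  with Z show ?thesis
    by simp
qed

section \<open>Reduction of all conditions to equality of the extreme multiplicities\<close>

theorem theorem7p6:
  fixes n p q :: nat and w :: "nat \<Rightarrow> nat" and Z :: "complex fps" and b :: "nat \<Rightarrow> int"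
  assumes q: "q = CARD('a::finite_field)" and p: "p = CHAR('a)"
    and w: "\<forall>i\<le>n. w i > 0"
    and Z: "Z = twist_zeta TYPE('a) n w"
    and b: "b = multiplicity_spectrum TYPE('a) n w"
  shows
    "(single_functional_equation (q ^ n) Z \<longleftrightarrow> (\<forall>j\<le>n. b j = b (n - j))) \<and>
     ((\<forall>j\<le>n. b j = b (n - j)) \<longleftrightarrow> b 0 = b n) \<and>
     (b 0 = b n \<longleftrightarrow> (\<forall>i\<le>n. \<forall>j\<le>n. prime_to_part p (w i) = prime_to_part p (w j))) \<and>
     (\<forall>c. (\<forall>i\<le>n. prime_to_part p (w i) = c) \<longrightarrow> (\<forall>j\<le>n. b j = int c)) \<and>
     (Gcd (w ` {..n}) = 1 \<longrightarrow>
        ((\<forall>i\<le>n. \<forall>j\<le>n. prime_to_part p (w i) = prime_to_part p (w j)) \<longleftrightarrow>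
           (\<forall>i\<le>n. \<exists>k. w i = p ^ k)) \<and>
        ((\<forall>i\<le>n. \<exists>k. w i = p ^ k) \<longrightarrow>
           (\<forall>S r. S \<subseteq> {..n} \<and> S \<noteq> {} \<and> r \<ge> 1 \<longrightarrow> gcd (Gcd (w ` S)) (q ^ r - 1) = 1) \<and>
           Z = projective_zeta TYPE('a) n \<and>
           projective_zeta TYPE('a) n = (\<Prod>j\<le>n. inverse (1 - fps_const (of_nat q ^ j) * fps_X))))"
proof -
  let ?D = "prime_to_weight_divisors p n w" and ?M = "eigenvalues p q n w"
  let ?full = "\<forall>d\<in>?D. divisible_weights n w d = Suc n"
  let ?eq = "\<forall>i\<le>n. \<forall>j\<le>n. prime_to_part p (w i) = prime_to_part p (w j)"
  have prime: "prime p"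
    unfolding p by (rule CHAR_prime)
  have q1: "q > 1"
    unfolding q by (rule CARD_finite_field_gt_1)
  have cop: "coprime d q" if "coprime d p" for d
    using that unfolding p q by (rule coprime_CHAR_imp_coprime_CARD)
  have M0: "0 \<notin># ?M"
    unfolding p q by (rule zero_notin_eigenvalues[OF w])
  have b_size: "b j = int (size {#a \<in># ?M. norm a = real q ^ j#})" for j
    unfolding b p q by (rule multiplicity_spectrum_eq_size[OF w])
  then have b_sum: "b j = int (\<Sum>d\<in>?D. if j < divisible_weights n w d then totient d else 0)" for j
    by (simp only: size_filter_norm_eigenvalues[OF w q1])
  have full_iff: "?full \<longleftrightarrow> ?eq"
    unfolding divisible_weights_full_iff[OF w] by (rule prime_to_weight_divisors_full_iff[OF prime w])
  have "b 0 = b n \<longleftrightarrow> ?full"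
    unfolding b_sum of_nat_eq_iff by (rule sum_if_divisible_weights_eq_iff[OF w])
  then have b0n: "b 0 = b n \<longleftrightarrow> ?eq"
    by (simp only: full_iff)
  have spectrum: "b j = int c" if c: "\<forall>i\<le>n. prime_to_part p (w i) = c" and "j \<le> n" for c j
  proof -
    have ?full
      using c full_iff by simp
    \<comment> \<open>Every d survives the condition on j, and by Gauss the totients of the divisors
      of c sum to c.\<close>
    then have "b j = int (\<Sum>d\<in>?D. totient d)"
      using \<open>j \<le> n\<close> unfolding b_sum by (intro arg_cong[of _ _ int] sum.cong) auto
    also have "(\<Sum>d\<in>?D. totient d) = c"
      unfolding prime_to_weight_divisors_const[OF prime w c] by (rule totient_divisor_sum)
    finally show ?thesis .
  qed
  have pal: "(\<forall>j\<le>n. b j = b (n - j)) \<longleftrightarrow> b 0 = b n"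
  proof
    assume "b 0 = b n"
    then have "\<forall>i\<le>n. prime_to_part p (w i) = prime_to_part p (w 0)"
      using b0n by blast
    from spectrum[OF this] show "\<forall>j\<le>n. b j = b (n - j)"
      by simp
  next
    assume "\<forall>j\<le>n. b j = b (n - j)"
    from this[rule_format, of 0] show "b 0 = b n"
      by simp
  qed
  have "single_functional_equation (q ^ n) Z \<longleftrightarrow> image_mset (\<lambda>a. of_nat (q ^ n) / a) ?M = ?M"
  proof (rule single_functional_equation_iff[OF M0])
    \<comment> \<open>The divisor 1 contributes to \<open>b 0\<close>, so there is at least one
      eigenvalue; this excludes the sign -1 in the functional equation.\<close>
    have "1 \<in> ?D"
      by (auto simp: prime_to_weight_divisors_def)
    then have "b 0 \<noteq> 0"
      using sum_pos2[OF finite_prime_to_weight_divisors[OF w] \<open>1 \<in> ?D\<close>,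
          of "\<lambda>d. if 0 < divisible_weights n w d then totient d else 0"]
        divisible_weights_full_iff[OF w, of 1]
      unfolding b_sum by (simp del: of_nat_sum)
    then show "?M \<noteq> {#}"
      unfolding b_size by auto
    show "Z * fps_of_poly (reciprocal_poly ?M) = 1"
      unfolding Z p q by (rule twist_zeta_mult_reciprocal_poly[OF w])
  qed (use q1 in simp)
  also have "\<dots> \<longleftrightarrow> b 0 = b n"
  proof
    assume sym: "image_mset (\<lambda>a. of_nat (q ^ n) / a) ?M = ?M"
    \<comment> \<open>The reflection exchanges the circles of radius 1 and q^n, so a symmetric
      multiset has equally many elements on both.\<close>
    have "{#a \<in># ?M. norm a = real q ^ 0#}
        = image_mset (\<lambda>a. of_nat (q ^ n) / a) {#a \<in># ?M. norm (of_nat (q ^ n) / a) = real q ^ 0#}"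
      by (subst (1) sym[symmetric]) (rule filter_mset_image_mset)
    also have "{#a \<in># ?M. norm (of_nat (q ^ n) / a) = real q ^ 0#} = {#a \<in># ?M. norm a = real q ^ n#}"
      using M0 by (intro filter_mset_cong) (auto simp: norm_divide norm_power field_simps)
    finally show "b 0 = b n"
      unfolding b_size by simp
  next
    assume "b 0 = b n"
    then have ?full
      by (simp only: b0n full_iff)
    then show "image_mset (\<lambda>a. of_nat (q ^ n) / a) ?M = ?M"
      using cop q1 by (intro reflect_eigenvalues[OF w]) auto
  qed
  finally have FE: "single_functional_equation (q ^ n) Z \<longleftrightarrow> b 0 = b n" .
  have eq_iff: "?eq \<longleftrightarrow> (\<forall>i\<le>n. \<exists>k. w i = p ^ k)" if "Gcd (w ` {..n}) = 1"
  proof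
    assume eq: ?eq
    \<comment> \<open>The common prime-to-p part divides every weight, hence their gcd 1, and only
      powers of p remain.\<close>
    have "prime_to_part p (w 0) dvd w i" if "i \<le> n" for i
      using eq that w prime_to_part_decompose(1)[OF prime, of "w i"] by (metis dvd_triv_right le0)
    then have "prime_to_part p (w 0) dvd Gcd (w ` {..n})"
      by (intro Gcd_greatest) auto
    then have "prime_to_part p (w 0) = 1"
      unfolding \<open>Gcd (w ` {..n}) = 1\<close> by simp
    then have "prime_to_part p (w i) = 1" if "i \<le> n" for i
      using eq that by (metis le0)
    then show "\<forall>i\<le>n. \<exists>k. w i = p ^ k"
      using w prime_to_part_decompose(1)[OF prime] by (metis mult_1_right)
  next
    assume "\<forall>i\<le>n. \<exists>k. w i = p ^ k"
    then show ?eq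
      by (metis prime_to_part_power[OF prime])
  qed
  have trivial: "gcd (Gcd (w ` S)) (q ^ r - 1) = 1"
    if pow: "\<forall>i\<le>n. \<exists>k. w i = p ^ k" and S: "S \<subseteq> {..n}" "S \<noteq> {}" and r: "r \<ge> 1" for S r
  proof -
    obtain i k where "i \<in> S" "w i = p ^ k"
      using pow S by blast
    \<comment> \<open>A single member of S suffices: the gcd is a divisor of a power of p, whereas
      q^r - 1 is prime to p.\<close>
    then have "Gcd (w ` S) dvd p ^ k"
      using Gcd_dvd[OF imageI[of i S w]] by simp
    moreover have "\<not> p dvd q ^ r - 1"
      using not_CHAR_dvd[of r "q ^ r - 1", where ?'a = 'a] r unfolding p q by simp
    then have "coprime (p ^ k) (q ^ r - 1)"
      using prime by (simp add: prime_imp_coprime)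
    ultimately have "coprime (Gcd (w ` S)) (q ^ r - 1)"
      using coprime_divisors[OF _ dvd_refl] by blast
    then show ?thesis
      by simp
  qed
  \<comment> \<open>Projective space has all weights equal to 1, that is, p^0, so it is covered by
    the case of prime power weights.\<close>
  have proj: "projective_zeta TYPE('a) n = (\<Prod>j\<le>n. inverse (1 - fps_const (of_nat q ^ j) * fps_X))"
    unfolding projective_zeta_eq_twist_zeta q
    by (rule twist_zeta_prime_power_weights) (auto intro: exI[of _ 0])
  have Zproj: "Z = projective_zeta TYPE('a) n" if "\<forall>i\<le>n. \<exists>k. w i = p ^ k"
    using that unfolding proj unfolding Z p q by (rule twist_zeta_prime_power_weights)
  show ?thesis
  proof (intro conjI impI allI)
    show "single_functional_equation (q ^ n) Z \<longleftrightarrow> (\<forall>j\<le>n. b j = b (n - j))"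
      by (simp only: FE pal)
    show "gcd (Gcd (w ` S)) (q ^ r - 1) = 1"
      if "\<forall>i\<le>n. \<exists>k. w i = p ^ k" "S \<subseteq> {..n} \<and> S \<noteq> {} \<and> 1 \<le> r" for S r
      using that by (intro trivial) simp_all
    show "b j = int c" if "\<forall>i\<le>n. prime_to_part p (w i) = c" "j \<le> n" for c j
      using that by (rule spectrum)
  qed (rule pal b0n proj eq_iff Zproj; assumption)+
qed

end
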